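(* Let $|\rho|\le1$ and let $\{W_{N,\rho}(k)\}_{k\in\mathbb N}$ be a Wigner process with correlation parameter $\rho$. Then for all $n\in\mathbb N$, $$\lim_{N\to\infty}\varphi_N\left(\frac{W_{N,\rho}(1)}{\sqrt N}\,\frac{W_{N,\rho}(2)}{\sqrt N}\cdots\frac{W_{N,\rho}(2n-1)}{\sqrt N}\right)=0,$$ $$\lim_{N\to\infty}\varphi_N\left(\frac{W_{N,\rho}(1)}{\sqrt N}\,\frac{W_{N,\rho}(2)}{\sqrt N}\cdots\frac{W_{N,\rho}(2n)}{\sqrt N}\right)=\rho^n\sum_{\mathscr V\in NC_2(2n)}\rho^{2\,\mathrm{nest}(\mathscr V)}.$$ In particular, for $\rho\in(0,1]$ and all $n\in\mathbb N$, $$\lim_{N\to\infty}\varphi_N\left(\frac{W_{N,\rho}(1)}{\sqrt N}\,\frac{W_{N,\rho}(2)}{\sqrt N}\cdots\frac{W_{N,\rho}(n)}{\sqrt N}\right)=\varphi_{0,t}(s_{0,t}(h)^n)$$ for $t=\rho^2$ and $\|h\|_{\mathscr H}=\sqrt\rho$.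
   Context: Wigner process: for each $N$, a sequence $\{W_{N,\rho}(k)\}_{k\in\mathbb N}$ of self-adjoint $N\times N$ random matrices with entries $w_{i,j}(k)$ having all moments finite, such that: for each $k$, the entries $\{w_{i,j}(k)\}_{1\le i\le j\le N}$ are jointly independent with $\mathbb E(w_{i,j}(k))=0$, $\mathbb E(|w_{i,j}(k)|^2)=1$; $\mathbb E(|w_{i,j}(k)|^n)\le c_n$ for all $n$, with $c_n$ independent of $i,j,k,N$; the processes $(w_{i,j}(k))_{k\in\mathbb N}$, $i\le j$, are independent; and $\mathbb E(w_{i,j}(k)w_{i,j}(m))=\rho^{m-k}$ for all $1\le k\le m$ (taking $m=k$ shows that the entries are a.s. real). $\varphi_N=\frac1N\mathrm{Tr}\otimes\mathbb E$. $NC_2(2n)$ is the set of non-crossing pair partitions of $\{1,\dots,2n\}$ (no two blocks $(w_i,z_i),(w_j,z_j)$ with $w_i<w_j<z_i<z_j$); $\mathrm{nest}(\mathscr V)$ is the number of pairs of blocks with $w_i<w_j<z_j<z_i$. Convention $0^0=1$. For $0<t\le1$ and a real separable Hilbert space $\mathscr H$, $\mathscr F_{0,t}$ is the Hilbert space completion of $\mathbb C\Omega\oplus\bigoplus_{n\ge1}\mathscr H_{\mathbb C}^{\otimes n}$ (algebraic, $\Omega$ a unit vector) for the inner product in which different tensor degrees are orthogonal and $\langle g_1\otimes\cdots\otimes g_n,h_1\otimes\cdots\otimes h_n\rangle_{0,t}=t^{\binom n2}\prod_i\langle g_i,h_i\rangle$. For $h\in\mathscr H$, $a_{0,t}(h)^\ast\Omega=h$,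 $a_{0,t}(h)^\ast h_1\otimes\cdots\otimes h_n=h\otimes h_1\otimes\cdots\otimes h_n$, $a_{0,t}(h)\Omega=0$, $a_{0,t}(h)h_1\otimes\cdots\otimes h_n=t^{n-1}\langle h,h_1\rangle h_2\otimes\cdots\otimes h_n$ (equal to $\langle h,h_1\rangle\Omega$ for $n=1$); these extend to bounded mutually adjoint operators. $s_{0,t}(h)=a_{0,t}(h)+a_{0,t}(h)^\ast$ and $\varphi_{0,t}(b)=\langle\Omega,b\Omega\rangle_{0,t}$. *)

theory Defs
  imports
    "HOL-Probability.Probability"
    "HOL-Library.Poly_Mapping"
    "HOL-Library.Disjoint_Sets"
    "Jordan_Normal_Form.Schur_Decomposition"
begin

section \<open>Wigner processes\<close>

text \<open>
  \<open>W N k \<omega>\<close> is the \<open>N \<times> N\<close> matrix at time \<open>k\<close>, for \<open>k \<ge> 1\<close>; the underlying probability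
  space \<open>M N\<close> may depend on \<open>N\<close>.  Matrix indices run over \<open>0, \<dots>, N - 1\<close>.
\<close>

locale wigner_process =
  fixes \<rho> :: real
    and M :: "nat \<Rightarrow> 'w measure"
    and W :: "nat \<Rightarrow> nat \<Rightarrow> 'w \<Rightarrow> complex mat"
  assumes prob_space: "N \<ge> 1 \<Longrightarrow> prob_space (M N)"
    and carrier: "N \<ge> 1 \<Longrightarrow> k \<ge> 1 \<Longrightarrow> \<omega> \<in> space (M N) \<Longrightarrow> W N k \<omega> \<in> carrier_mat N N"
    and self_adjoint:
      "N \<ge> 1 \<Longrightarrow> k \<ge> 1 \<Longrightarrow> \<omega> \<in> space (M N) \<Longrightarrow> mat_adjoint (W N k \<omega>) = W N k \<omega>"
    and measurable:
      "k \<ge> 1 \<Longrightarrow> i < N \<Longrightarrow> j < N \<Longrightarrow> (\<lambda>\<omega>. W N k \<omega> $$ (i, j)) \<in> borel_measurable (M N)"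
    and moments_finite:
      "k \<ge> 1 \<Longrightarrow> i < N \<Longrightarrow> j < N \<Longrightarrow> integrable (M N) (\<lambda>\<omega>. cmod (W N k \<omega> $$ (i, j)) ^ n)"
    and indep_entries:
      "N \<ge> 1 \<Longrightarrow> k \<ge> 1 \<Longrightarrow>
        prob_space.indep_vars (M N) (\<lambda>_. borel) (\<lambda>(i, j) \<omega>. W N k \<omega> $$ (i, j))
          {(i, j). i \<le> j \<and> j < N}"
    and mean_zero:
      "k \<ge> 1 \<Longrightarrow> i < N \<Longrightarrow> j < N \<Longrightarrow> (\<integral>\<omega>. W N k \<omega> $$ (i, j) \<partial>M N) = 0"
    and variance_one:
      "k \<ge> 1 \<Longrightarrow> i < N \<Longrightarrow> j < N \<Longrightarrow> (\<integral>\<omega>. (cmod (W N k \<omega> $$ (i, j)))\<^sup>2 \<partial>M N) = 1"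
    and moments_bounded:
      "\<exists>c :: nat \<Rightarrow> real. \<forall>n N k i j. k \<ge> 1 \<longrightarrow> i < N \<longrightarrow> j < N \<longrightarrow>
        (\<integral>\<omega>. cmod (W N k \<omega> $$ (i, j)) ^ n \<partial>M N) \<le> c n"
    and indep_processes:
      "N \<ge> 1 \<Longrightarrow>
        prob_space.indep_vars (M N) (\<lambda>_. PiM {1..} (\<lambda>_. borel))
          (\<lambda>(i, j) \<omega>. \<lambda>k\<in>{1..}. W N k \<omega> $$ (i, j)) {(i, j). i \<le> j \<and> j < N}"
    and covariance:
      "1 \<le> k \<Longrightarrow> k \<le> m \<Longrightarrow> i < N \<Longrightarrow> j < N \<Longrightarrow>
        (\<integral>\<omega>. W N k \<omega> $$ (i, j) * W N m \<omega> $$ (i, j) \<partial>M N) = complex_of_real (\<rho> ^ (m - k))"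

definition mat_trace :: "complex mat \<Rightarrow> complex" where
  "mat_trace A = (\<Sum>i<dim_row A. A $$ (i, i))"

text \<open>The state \<open>(1/N) Tr \<otimes> E\<close> on random \<open>N \<times> N\<close> matrices over the probability space \<open>P\<close>.\<close>

definition trace_state :: "'w measure \<Rightarrow> nat \<Rightarrow> ('w \<Rightarrow> complex mat) \<Rightarrow> complex" where
  "trace_state P N A = (\<integral>\<omega>. mat_trace (A \<omega>) \<partial>P) / of_nat N"

text \<open>\<open>W N 1 / \<surd>N * W N 2 / \<surd>N * \<dots> * W N m / \<surd>N\<close>, in this order.\<close>

definition scaled_product ::
    "(nat \<Rightarrow> nat \<Rightarrow> 'w \<Rightarrow> complex mat) \<Rightarrow> nat \<Rightarrow> nat \<Rightarrow> 'w \<Rightarrow> complex mat" where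
  "scaled_product W N m \<omega> =
    foldr (*) (map (\<lambda>k. complex_of_real (1 / sqrt (real N)) \<cdot>\<^sub>m W N k \<omega>) [1..<Suc m]) (1\<^sub>m N)"


section \<open>Non-crossing pair partitions\<close>

text \<open>A block \<open>(w, z)\<close> with \<open>w < z\<close> is the two-element set \<open>B\<close> with \<open>w = Min B\<close>, \<open>z = Max B\<close>.\<close>

definition NC2 :: "nat \<Rightarrow> nat set set set" where
  "NC2 m = {V. partition_on {1..m} V \<and> (\<forall>B\<in>V. card B = 2) \<and>
    \<not> (\<exists>B\<in>V. \<exists>C\<in>V. Min B < Min C \<and> Min C < Max B \<and> Max B < Max C)}"

definition nest :: "nat set set \<Rightarrow> nat" where
  "nest V = card {(B, C). B \<in> V \<and> C \<in> V \<and> Min B < Min C \<and> Min C < Max C \<and> Max C < Max B}"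


section \<open>The Fock space with weights \<open>t ^ (n choose 2)\<close>\<close>

text \<open>
  The pair \<open>(x, y)\<close> stands for \<open>x + \<i> y\<close> in the complexification of the real inner product space
  \<open>'h\<close>.  Complex inner products are conjugate-linear in the first argument.
\<close>

definition hc_inner :: "'h::real_inner \<times> 'h \<Rightarrow> 'h \<times> 'h \<Rightarrow> complex" where
  "hc_inner u v = Complex (inner (fst u) (fst v) + inner (snd u) (snd v))
                          (inner (fst u) (snd v) - inner (snd u) (fst v))"

text \<open>
  The list \<open>[g\<^sub>1, \<dots>, g\<^sub>n]\<close> stands for the elementary tensor \<open>g\<^sub>1 \<otimes> \<dots> \<otimes> g\<^sub>n\<close> and \<open>[]\<close> for the
  vacuum; \<open>'h prefock\<close> consists of formal finite linear combinations of elementary tensors.  For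
  \<open>t > 0\<close> the null vectors of \<open>fock_form t\<close> are exactly the combinations that vanish by the
  multilinearity relations of the algebraic tensor powers, since the form is positive definite on
  the latter.  Hence the completion below, which identifies elements at distance zero, is the
  completion of the algebraic Fock space.
\<close>

type_synonym 'h prefock = "('h \<times> 'h) list \<Rightarrow>\<^sub>0 complex"

definition word_inner :: "real \<Rightarrow> ('h::real_inner \<times> 'h) list \<Rightarrow> ('h \<times> 'h) list \<Rightarrow> complex" where
  "word_inner t u v =
    (if length u = length v
     then complex_of_real (t ^ (length u choose 2)) * (\<Prod>i<length u. hc_inner (u ! i) (v ! i))
     else 0)"

definition fock_form :: "real \<Rightarrow> 'h::real_inner prefock \<Rightarrow> 'h prefock \<Rightarrow> complex" where
  "fock_form t p q =
    (\<Sum>u\<in>Poly_Mapping.keys p. \<Sum>v\<in>Poly_Mapping.keys q.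
      cnj (Poly_Mapping.lookup p u) * Poly_Mapping.lookup q v * word_inner t u v)"

definition fock_norm :: "real \<Rightarrow> 'h::real_inner prefock \<Rightarrow> real" where
  "fock_norm t p = sqrt (Re (fock_form t p p))"

text \<open>The completion: Cauchy sequences modulo sequences tending to zero.\<close>

definition fock_cauchy :: "real \<Rightarrow> (nat \<Rightarrow> 'h::real_inner prefock) set" where
  "fock_cauchy t = {X. \<forall>e>0. \<exists>K. \<forall>m\<ge>K. \<forall>n\<ge>K. fock_norm t (X m - X n) < e}"

definition fock_rel :: "real \<Rightarrow> ((nat \<Rightarrow> 'h::real_inner prefock) \<times> (nat \<Rightarrow> 'h prefock)) set" where
  "fock_rel t = {(X, Y). X \<in> fock_cauchy t \<and> Y \<in> fock_cauchy t \<and>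
    (\<lambda>n. fock_norm t (X n - Y n)) \<longlonglongrightarrow> 0}"

type_synonym 'h fock = "(nat \<Rightarrow> 'h prefock) set"

definition fock_space :: "real \<Rightarrow> 'h::real_inner fock set" where
  "fock_space t = fock_cauchy t // fock_rel t"

definition fock_inner :: "real \<Rightarrow> 'h::real_inner fock \<Rightarrow> 'h fock \<Rightarrow> complex" where
  "fock_inner t A B = the_elem (\<Union>X\<in>A. \<Union>Y\<in>B. {lim (\<lambda>n. fock_form t (X n) (Y n))})"

definition fock_add :: "real \<Rightarrow> 'h::real_inner fock \<Rightarrow> 'h fock \<Rightarrow> 'h fock" where
  "fock_add t A B = (\<Union>X\<in>A. \<Union>Y\<in>B. fock_rel t `` {\<lambda>n. X n + Y n})"

definition fock_vacuum :: "real \<Rightarrow> 'h::real_inner fock" where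
  "fock_vacuum t = fock_rel t `` {\<lambda>_. Poly_Mapping.single [] 1}"

text \<open>The continuous extension to \<open>fock_space t\<close> of a linear map bounded for \<open>fock_norm t\<close>.\<close>

definition fock_extend ::
    "real \<Rightarrow> ('h::real_inner prefock \<Rightarrow> 'h prefock) \<Rightarrow> 'h fock \<Rightarrow> 'h fock" where
  "fock_extend t f A = (\<Union>X\<in>A. fock_rel t `` {\<lambda>n. f (X n)})"

definition pre_creation :: "'h::real_inner \<Rightarrow> 'h prefock \<Rightarrow> 'h prefock" where
  "pre_creation h p =
    (\<Sum>u\<in>Poly_Mapping.keys p. Poly_Mapping.single ((h, 0) # u) (Poly_Mapping.lookup p u))"

definition pre_annihilation :: "real \<Rightarrow> 'h::real_inner \<Rightarrow> 'h prefock \<Rightarrow> 'h prefock" where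
  "pre_annihilation t h p =
    (\<Sum>u\<in>Poly_Mapping.keys p - {[]}. Poly_Mapping.single (tl u)
      (complex_of_real (t ^ (length u - 1)) * hc_inner (h, 0) (hd u) * Poly_Mapping.lookup p u))"

definition creation :: "real \<Rightarrow> 'h::real_inner \<Rightarrow> 'h fock \<Rightarrow> 'h fock" where
  "creation t h = fock_extend t (pre_creation h)"

definition annihilation :: "real \<Rightarrow> 'h::real_inner \<Rightarrow> 'h fock \<Rightarrow> 'h fock" where
  "annihilation t h = fock_extend t (pre_annihilation t h)"

definition semicircular :: "real \<Rightarrow> 'h::real_inner \<Rightarrow> 'h fock \<Rightarrow> 'h fock" where
  "semicircular t h A = fock_add t (annihilation t h A) (creation t h A)"

definition vacuum_state :: "real \<Rightarrow> ('h::real_inner fock \<Rightarrow> 'h fock) \<Rightarrow> complex" where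
  "vacuum_state t b = fock_inner t (fock_vacuum t) (b (fock_vacuum t))"

end

theory Submission
  imports Defs
begin

text \<open>
  The trace of the product expands into a sum over closed walks with \<open>m\<close> steps on \<open>N\<close> vertices.  The
  processes of distinct edges are independent and centred, so only walks using every edge at least
  twice contribute.  A walk has at most one vertex more than it has edges; hence, after division by
  \<open>N ^ (m / 2 + 1)\<close>, only the walks with \<open>m / 2 + 1\<close> vertices survive, and these use every edge exactly
  twice.  Such a walk has a vertex which it visits only once, away from its base point; deleting the
  two steps there shows inductively that the pairing of the steps by edges is non-crossing, and that
  each non-crossing pairing arises from \<open>N (N - 1) \<dots> (N - m / 2)\<close> walks.  Each of them contributes the
  product of \<open>\<rho> ^ (b - a)\<close> over the blocks \<open>{a, b}\<close>, where \<open>b - a - 1\<close> is twice the number of blocks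
  nested inside \<open>{a, b}\<close>.

  Reading a pairing from left to right, each point either opens an arc or closes the last opened one.
  This gives the recursion satisfied by the vacuum moments of \<open>s(h)\<close>, up to the normalization
  \<open>\<rho> ^ (k (k + 1) / 2)\<close> with \<open>k\<close> arcs open.  On the Fock space the form is a sum of Schur products of Gram
  matrices, hence positive; creation is bounded by the same positivity and annihilation is its adjoint.
\<close>


section \<open>Closed walks\<close>

text \<open>Removing the two steps at a vertex visited once has to produce an object of the same
  kind. Therefore steps carry their times as labels, walks and pairings live over arbitrary
  increasing lists of times instead of 1, ..., m, and blocks are sets of times: a deletion leaves
  all other labels and blocks untouched. A second obstacle is direction. A walk reads the entry (x,
  y) along its step, whereas independence is assumed only for the entries with i \<le> j. The
  covariance at equal times forces the entries to be real almost surely, so self-adjointness becomes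
  symmetry and a step may be replaced by its undirected edge, encoded as (min, max) and hence
  already an index of the independent family. The moment bounds are uniform in N, so the walks with
  too few vertices need only be counted up to a constant: at most ceil(m/2) vertices allow
  O(N^ceil(m/2)) walks, which loses at least a factor sqrt N against N^(m/2 + 1). On the Fock side
  the form has null vectors on formal combinations, so every estimate is made for a semidefinite
  form and only then carried to the completion.\<close>

definition uedge :: "nat \<Rightarrow> nat \<Rightarrow> nat \<times> nat" where
  "uedge x y = (min x y, max x y)"

lemma uedge_eq_iff: "uedge a b = uedge c d \<longleftrightarrow> a = c \<and> b = d \<or> a = d \<and> b = c"
  by (auto simp: uedge_def min_def max_def split: if_splits)

text \<open>A walk is a starting vertex together with a list of pairs (time of the step, vertex reached).\<close>

fun tedges :: "nat \<Rightarrow> (nat \<times> nat) list \<Rightarrow> (nat \<times> nat \<times> nat) set" where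
  "tedges x [] = {}"
| "tedges x ((t, y) # ws) = insert (t, uedge x y) (tedges y ws)"

fun endpoint :: "nat \<Rightarrow> (nat \<times> nat) list \<Rightarrow> nat" where
  "endpoint x [] = x"
| "endpoint x ((t, y) # ws) = endpoint y ws"

definition verts :: "nat \<Rightarrow> (nat \<times> nat) list \<Rightarrow> nat set" where
  "verts x ws = insert x (snd ` set ws)"

definition edges :: "nat \<Rightarrow> (nat \<times> nat) list \<Rightarrow> (nat \<times> nat) set" where
  "edges x ws = snd ` tedges x ws"

definition etimes :: "nat \<Rightarrow> (nat \<times> nat) list \<Rightarrow> nat \<times> nat \<Rightarrow> nat set" where
  "etimes x ws e = {t. (t, e) \<in> tedges x ws}"

text \<open>When all blocks are pairs, independence and the covariance hypothesis make the
  expectation of a walk a function of this partition alone; this is why walks are sorted by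
  it.\<close>

definition kernel_partition :: "nat \<Rightarrow> (nat \<times> nat) list \<Rightarrow> nat set set" where
  "kernel_partition x ws = etimes x ws ` edges x ws"

lemma endpoint_append [simp]: "endpoint x (as @ bs) = endpoint (endpoint x as) bs"
  by (induction x as rule: endpoint.induct) auto

lemma tedges_append [simp]: "tedges x (as @ bs) = tedges x as \<union> tedges (endpoint x as) bs"
  by (induction x as rule: tedges.induct) auto

lemma finite_tedges [simp]: "finite (tedges x ws)"
  by (induction x ws rule: tedges.induct) auto

lemma edges_iff: "e \<in> edges x ws \<longleftrightarrow> (\<exists>t. (t, e) \<in> tedges x ws)"
  by (force simp: edges_def)

lemma finite_edges [simp]: "finite (edges x ws)"
  by (simp add: edges_def)

lemma finite_verts [simp]: "finite (verts x ws)"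
  by (simp add: verts_def)

lemma fst_tedges: "fst ` tedges x ws = fst ` set ws"
  by (induction x ws rule: tedges.induct) auto

lemma tedges_fst: "(t, e) \<in> tedges x ws \<Longrightarrow> t \<in> fst ` set ws"
  by (metis fst_conv fst_tedges image_eqI)

lemma tedges_vertsE:
  assumes "(t, e) \<in> tedges x ws"
  obtains a b where "e = uedge a b" "a \<in> verts x ws" "b \<in> verts x ws"
proof -
  have "\<exists>a b. e = uedge a b \<and> a \<in> verts x ws \<and> b \<in> verts x ws"
    using assms
  proof (induction x ws rule: tedges.induct)
    case (2 x s y ws)
    show ?case
    proof (cases "(t, e) \<in> tedges y ws")
      case True
      then show ?thesis using "2.IH" by (fastforce simp: verts_def)
    next
      case False
      then have "e = uedge x y" using "2.prems" by auto
      then show ?thesis by (force simp: verts_def)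
    qed
  qed auto
  then show ?thesis using that by blast
qed

lemma endpoint_in_verts: "endpoint x ws \<in> verts x ws"
  by (induction x ws rule: endpoint.induct) (auto simp: verts_def)

lemma tedges_functional:
  "distinct (map fst ws) \<Longrightarrow> (t, e) \<in> tedges x ws \<Longrightarrow> (t, e') \<in> tedges x ws \<Longrightarrow> e = e'"
proof (induction x ws rule: tedges.induct)
  case (2 x s y ws)
  then show ?case using tedges_fst by fastforce
qed auto

lemma card_tedges: "distinct (map fst ws) \<Longrightarrow> card (tedges x ws) = length ws"
proof (induction x ws rule: tedges.induct)
  case (2 x s y ws)
  then have "(s, uedge x y) \<notin> tedges y ws" using tedges_fst[of s "uedge x y" y ws] by auto
  then show ?case using 2 by simp
qed auto

lemma sum_card_etimes:
  assumes "distinct (map fst ws)"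
  shows "(\<Sum>e\<in>edges x ws. card (etimes x ws e)) = length ws"
proof -
  have "(\<Sum>e\<in>edges x ws. card (etimes x ws e))
      = (\<Sum>e\<in>edges x ws. \<Sum>p | p \<in> tedges x ws \<and> snd p = e. 1)"
  proof (rule sum.cong[OF refl])
    fix e
    have "{p \<in> tedges x ws. snd p = e} = (\<lambda>t. (t, e)) ` etimes x ws e"
      by (auto simp: etimes_def)
    then show "card (etimes x ws e) = (\<Sum>p | p \<in> tedges x ws \<and> snd p = e. 1)"
      by (simp add: card_image inj_on_def)
  qed
  also have "\<dots> = (\<Sum>p\<in>tedges x ws. 1)"
    by (rule sum.group) (auto simp: edges_def)
  finally show ?thesis using assms by (simp add: card_tedges)
qed

lemma inj_on_etimes:
  assumes "distinct (map fst ws)"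
  shows "inj_on (etimes x ws) (edges x ws)"
proof (rule inj_onI)
  fix e f assume ef: "e \<in> edges x ws" "f \<in> edges x ws" "etimes x ws e = etimes x ws f"
  then obtain t where t: "(t, e) \<in> tedges x ws" unfolding edges_iff by blast
  then have "(t, f) \<in> tedges x ws" using ef(3) by (auto simp: etimes_def)
  then show "e = f" using t tedges_functional[OF assms] by blast
qed

lemma finite_etimes [simp]: "finite (etimes x ws e)"
  by (rule finite_subset[of _ "fst ` tedges x ws"]) (force simp: etimes_def)+

text \<open>Peel off the first step: if its starting vertex does not recur in the rest of the walk,
  then neither does the edge leaving it, so a new vertex always costs a new edge.\<close>

lemma card_verts_le: "card (verts x ws) \<le> card (edges x ws) + 1"
proof (induction x ws rule: tedges.induct)
  case (1 x)
  then show ?case by (simp add: verts_def)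
next
  case (2 x t y ws)
  have V: "verts x ((t, y) # ws) = insert x (verts y ws)" by (auto simp: verts_def)
  have E: "edges x ((t, y) # ws) = insert (uedge x y) (edges y ws)" by (auto simp: edges_def)
  show ?case
  proof (cases "x \<in> verts y ws")
    case True
    then show ?thesis using 2 unfolding V E by (simp add: insert_absorb card_insert_if)
  next
    case False
    have "uedge x y \<notin> edges y ws"
    proof
      assume "uedge x y \<in> edges y ws"
      then obtain s where "(s, uedge x y) \<in> tedges y ws" by (auto simp: edges_def)
      then show False using False by (elim tedges_vertsE) (auto simp: uedge_eq_iff)
    qed
    then show ?thesis using 2 False unfolding V E by simp
  qed
qed

text \<open>A spike is an excursion to \<open>v\<close> and straight back. It returns to the
  endpoint of \<open>as\<close>, so the walk closes up again to \<open>as @ bs\<close> when the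
  spike is removed.\<close>

lemma tedges_spike:
  "tedges x (as @ (s, v) # (t, endpoint x as) # bs) =
    insert (s, uedge (endpoint x as) v) (insert (t, uedge (endpoint x as) v) (tedges x (as @ bs)))"
  by (auto simp: uedge_eq_iff)

lemma verts_spike: "verts x (as @ (s, v) # (t, endpoint x as) # bs) = insert v (verts x (as @ bs))"
  using endpoint_in_verts[of x as] by (auto simp: verts_def)

text \<open>Counting: if every entry other than \<open>x\<close> occurred at least twice, the list
  would have length at least \<open>2 * card (set vs) - 1\<close>.\<close>

lemma count_list_once:
  assumes "length vs + 2 \<le> 2 * card (set vs)"
  shows "\<exists>v \<in> set vs. v \<noteq> x \<and> count_list vs v = 1"
proof (rule ccontr)
  assume neg: "\<not> ?thesis"
  have ge: "count_list vs v \<ge> 2" if "v \<in> set vs - {x}" for v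
  proof -
    have "count_list vs v \<noteq> 0" using that by (simp add: count_list_0_iff)
    moreover have "count_list vs v \<noteq> 1" using neg that by blast
    ultimately show ?thesis by simp
  qed
  have "2 * card (set vs - {x}) = (\<Sum>v\<in>set vs - {x}. 2)" by simp
  also have "\<dots> \<le> (\<Sum>v\<in>set vs - {x}. count_list vs v)"
    using ge by (intro sum_mono) auto
  finally have *: "2 * card (set vs - {x}) \<le> (\<Sum>v\<in>set vs - {x}. count_list vs v)" .
  have "length vs = (\<Sum>v\<in>set vs. count_list vs v)" by (simp add: sum_count_set)
  show False
  proof (cases "x \<in> set vs")
    case True
    then have "count_list vs x \<ge> 1"
      by (metis count_list_0_iff less_one not_le)
    moreover have "(\<Sum>v\<in>set vs. count_list vs v) = count_list vs x + (\<Sum>v\<in>set vs - {x}. count_list vs v)"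
      using True by (simp add: sum.remove)
    moreover have "card (set vs) = Suc (card (set vs - {x}))"
      using True by (metis List.finite_set card.remove)
    ultimately show False using * assms \<open>length vs = _\<close> by linarith
  next
    case False
    then show False using * assms \<open>length vs = _\<close> by simp
  qed
qed

text \<open>A closed walk with so many vertices visits some vertex exactly once, away from its base point;
  the two steps at this vertex must use the same edge.\<close>

lemma exists_spike:
  assumes closed: "endpoint x ws = x" and ne: "ws \<noteq> []"
    and many: "length ws + 2 \<le> 2 * card (verts x ws)"
    and rep: "\<And>t e. (t, e) \<in> tedges x ws \<Longrightarrow> \<exists>t'. t' \<noteq> t \<and> (t', e) \<in> tedges x ws"
  obtains as s v t bs where "ws = as @ (s, v) # (t, endpoint x as) # bs" "v \<notin> verts x (as @ bs)"
proof -
  \<comment> \<open>The walk is closed, so its final vertex repeats \<open>x\<close>. Dropping it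
    lists each visit of the cyclic walk once, and \<open>vs\<close> has as many entries as there are
    steps.\<close>
  define vs where "vs = x # map snd (butlast ws)"
  obtain l where ws: "ws = butlast ws @ [(l, x)]"
  proof -
    obtain l z where lz: "last ws = (l, z)" by fastforce
    then have "ws = butlast ws @ [(l, z)]" using ne by (metis append_butlast_last_id)
    moreover from this have "z = x" using closed
      by (metis endpoint.simps endpoint_append)
    ultimately show thesis using that by simp
  qed
  have "set vs = verts x ws"
    by (subst ws) (auto simp: vs_def verts_def)
  moreover have "length vs = length ws" using ne by (simp add: vs_def)
  ultimately obtain v where v: "v \<in> set vs" "v \<noteq> x" "count_list vs v = 1"
    using many count_list_once[of vs x] by force
  then have "v \<in> snd ` set (butlast ws)" by (auto simp: vs_def)
  then obtain s as cs where bl: "butlast ws = as @ (s, v) # cs"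
    by (metis in_set_conv_decomp prod.collapse imageE)
  have vn: "v \<notin> snd ` set as" "v \<notin> snd ` set cs"
    using v by (auto simp: vs_def bl count_list_0_iff count_notin[symmetric] split: if_splits)
  obtain t y bs where cs: "cs @ [(l, x)] = (t, y) # bs" by (cases "cs @ [(l, x)]") auto
  have vy: "v \<notin> insert y (snd ` set bs)"
  proof -
    have "v \<notin> snd ` set (cs @ [(l, x)])" using vn v by auto
    then show ?thesis unfolding cs by simp
  qed
  have ws': "ws = as @ (s, v) # (t, y) # bs" using ws bl cs by simp
  define a where "a = endpoint x as"
  have va: "v \<notin> verts x as" using vn v by (simp add: verts_def)
  then have "v \<noteq> a" unfolding a_def using endpoint_in_verts by metis
  have te: "tedges x ws = tedges x as \<union> {(s, uedge a v), (t, uedge v y)} \<union> tedges y bs"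
    unfolding ws' by (auto simp: a_def)
  \<comment> \<open>The edge into \<open>v\<close> must be used again. Since \<open>v\<close> occurs
    neither before nor after, only the step leaving \<open>v\<close> can do so, and that step
    therefore goes back to \<open>a\<close>.\<close>
  then obtain s' where s': "s' \<noteq> s" "(s', uedge a v) \<in> tedges x ws"
    using rep[of s "uedge a v"] by auto
  have "(s', uedge a v) \<notin> tedges x as" using va by (auto elim!: tedges_vertsE simp: uedge_eq_iff)
  moreover have "(s', uedge a v) \<notin> tedges y bs"
    using vy by (auto elim!: tedges_vertsE simp: uedge_eq_iff verts_def)
  ultimately have "uedge a v = uedge v y" using s' te by auto
  then have "y = a" using \<open>v \<noteq> a\<close> by (auto simp: uedge_eq_iff)
  show thesis
  proof
    show "ws = as @ (s, v) # (t, endpoint x as) # bs" using ws' \<open>y = a\<close> a_def by simp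
    show "v \<notin> verts x (as @ bs)" using vn v vy by (auto simp: verts_def)
  qed
qed

lemma etimes_spike:
  assumes "v \<notin> verts x (as @ bs)" "e \<noteq> uedge (endpoint x as) v"
  shows "etimes x (as @ (s, v) # (t, endpoint x as) # bs) e = etimes x (as @ bs) e"
  using assms unfolding etimes_def tedges_spike by auto

lemma spike_edge_new:
  assumes "v \<notin> verts x ws"
  shows "(r, uedge a v) \<notin> tedges x ws"
  using assms by (auto elim!: tedges_vertsE simp: uedge_eq_iff)

lemma etimes_spike_new:
  assumes "v \<notin> verts x (as @ bs)"
  shows "etimes x (as @ (s, v) # (t, endpoint x as) # bs) (uedge (endpoint x as) v) = {s, t}"
  using spike_edge_new[OF assms] unfolding etimes_def tedges_spike by auto

lemma edges_spike:
  "edges x (as @ (s, v) # (t, endpoint x as) # bs) =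
    insert (uedge (endpoint x as) v) (edges x (as @ bs))"
  unfolding edges_def tedges_spike by auto

lemma kernel_partition_spike:
  assumes "v \<notin> verts x (as @ bs)"
  shows "kernel_partition x (as @ (s, v) # (t, endpoint x as) # bs) =
    insert {s, t} (kernel_partition x (as @ bs))"
proof -
  let ?f = "uedge (endpoint x as) v"
  have "?f \<notin> edges x (as @ bs)" using spike_edge_new[OF assms] by (simp only: edges_iff) blast
  then have "etimes x (as @ (s, v) # (t, endpoint x as) # bs) ` edges x (as @ bs) =
     etimes x (as @ bs) ` edges x (as @ bs)"
    by (intro image_cong refl etimes_spike[OF assms]) blast
  then show ?thesis
    unfolding kernel_partition_def edges_spike by (simp add: etimes_spike_new[OF assms])
qed

text \<open>Induction by removing a spike. Its two times are neighbours in the order of times, so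
  its block crosses no other block. A crossing of two other blocks survives in the shorter walk,
  which has two steps and one vertex less and so still satisfies the inequality on the number of
  vertices.\<close>

lemma noncrossing_of_many_vertices:
  assumes "endpoint x ws = x" "sorted_wrt (<) (map fst ws)"
    and "length ws + 2 \<le> 2 * card (verts x ws)"
    and "\<And>e. e \<in> edges x ws \<Longrightarrow> card (etimes x ws e) = 2"
    and "e \<in> edges x ws" "e' \<in> edges x ws"
    and "t1 \<in> etimes x ws e" "t3 \<in> etimes x ws e" "t2 \<in> etimes x ws e'" "t4 \<in> etimes x ws e'"
    and "t1 < t2" "t2 < t3" "t3 < t4"
  shows False
  using assms
proof (induction "length ws" arbitrary: ws rule: less_induct)
  case less
  have rep: "\<exists>t'. t' \<noteq> t \<and> (t', f) \<in> tedges x ws" if "(t, f) \<in> tedges x ws" for t f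
  proof -
    have "f \<in> edges x ws" using that by (force simp: edges_def)
    then obtain a b where "etimes x ws f = {a, b}" "a \<noteq> b"
      using less.prems(4) by (metis card_2_iff)
    then have "a \<in> etimes x ws f" "b \<in> etimes x ws f" by auto
    then show ?thesis using \<open>a \<noteq> b\<close> unfolding etimes_def by (cases "a = t") auto
  qed
  have "ws \<noteq> []" using less.prems(5) by (auto simp: edges_def)
  obtain as s v t bs where ws: "ws = as @ (s, v) # (t, endpoint x as) # bs"
    and v: "v \<notin> verts x (as @ bs)"
    using exists_spike[OF less.prems(1) \<open>ws \<noteq> []\<close> less.prems(3) rep] by metis
  let ?f = "uedge (endpoint x as) v"
  note srt = less.prems(2)[unfolded ws]
  have "s < t" using srt by (auto simp: sorted_wrt_append)
  have tm: "r < s \<or> t < r" if "r \<in> fst ` set (as @ bs)" for r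
    using srt that by (fastforce simp: sorted_wrt_append)
  have tmE: "r < s \<or> t < r" if "r \<in> etimes x ws g" "g \<noteq> ?f" for r g
    using that tedges_fst[of r g x "as @ bs"] tm unfolding ws etimes_spike[OF v that(2)]
    by (auto simp: etimes_def)
  have f: "etimes x ws ?f = {s, t}" unfolding ws using etimes_spike_new[OF v] .
  have "e \<noteq> e'"
  proof
    assume "e = e'"
    then have "{t1, t2, t3} \<subseteq> etimes x ws e" using less.prems by auto
    moreover have "finite (etimes x ws e)"
      using less.prems(4,5) by (metis card.infinite zero_neq_numeral)
    ultimately have "card {t1, t2, t3} \<le> 2" using less.prems(4,5) by (metis card_mono)
    then show False using less.prems(11,12) by simp
  qed
  consider "e = ?f" | "e' = ?f" | "e \<noteq> ?f" "e' \<noteq> ?f" by blast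
  then show False
  proof cases
    case 1
    then have "t1 = s" "t3 = t" using f less.prems \<open>s < t\<close> by auto
    then show False using tmE[of t2 e'] 1 \<open>e \<noteq> e'\<close> less.prems by auto
  next
    case 2
    then have "t2 = s" "t4 = t" using f less.prems \<open>s < t\<close> by auto
    then show False using tmE[of t3 e] 2 \<open>e \<noteq> e'\<close> less.prems by auto
  next
    case 3
    note et = etimes_spike[OF v, of _ s t, folded ws]
    have mem: "g \<in> edges x ws \<longleftrightarrow> g \<in> edges x (as @ bs)" if "g \<noteq> ?f" for g
      using that unfolding ws edges_spike by simp
    have new: "?f \<notin> edges x (as @ bs)"
      using spike_edge_new[OF v] by (simp only: edges_iff) blast
    show False
    proof (rule less.hyps[of "as @ bs"])
      show "endpoint x (as @ bs) = x" using less.prems(1) ws by simp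
      show "sorted_wrt (<) (map fst (as @ bs))" using srt by (auto simp: sorted_wrt_append)
      show "length (as @ bs) + 2 \<le> 2 * card (verts x (as @ bs))"
        using less.prems(3) v unfolding ws verts_spike by simp
      show "card (etimes x (as @ bs) g) = 2" if "g \<in> edges x (as @ bs)" for g
        using that new et[of g] mem[of g] less.prems(4)[of g] by metis
    qed (use 3 et mem less.prems ws in auto)
  qed
qed

section \<open>Non-crossing pairings\<close>

text \<open>An arbitrary ground set, instead of \<open>{1..m}\<close>, makes the class closed under
  removing a block together with its points.\<close>

definition nc_pairings :: "nat set \<Rightarrow> nat set set set" where
  "nc_pairings S = {V. partition_on S V \<and> (\<forall>B\<in>V. card B = 2) \<and>
    \<not> (\<exists>B\<in>V. \<exists>C\<in>V. Min B < Min C \<and> Min C < Max B \<and> Max B < Max C)}"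

lemma NC2_eq: "NC2 m = nc_pairings {1..m}"
  by (simp add: NC2_def nc_pairings_def)

lemma card_2_natE:
  assumes "card (B :: nat set) = 2"
  obtains a b where "B = {a, b}" "a < b" "Min B = a" "Max B = b"
proof -
  obtain a b where "B = {a, b}" "a \<noteq> b" using assms by (metis card_2_iff)
  then show thesis using that[of a b] that[of b a] by (cases "a < b") (auto simp: insert_commute)
qed

lemma Min_Max_pair [simp]:
  assumes "(a :: nat) < b" shows "Min {a, b} = a" "Max {a, b} = b"
  using assms by auto

lemma nc_pairings_pairs: "V \<in> nc_pairings S \<Longrightarrow> B \<in> V \<Longrightarrow> card B = 2"
  by (simp add: nc_pairings_def)

lemma nc_pairings_partition: "V \<in> nc_pairings S \<Longrightarrow> partition_on S V"
  by (simp add: nc_pairings_def)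

lemma nc_pairings_disjoint:
  "V \<in> nc_pairings S \<Longrightarrow> B \<in> V \<Longrightarrow> C \<in> V \<Longrightarrow> c \<in> B \<Longrightarrow> c \<in> C \<Longrightarrow> B = C"
  using nc_pairings_partition[of V S] unfolding partition_on_def disjoint_def by blast

lemma nc_pairings_Union: "V \<in> nc_pairings S \<Longrightarrow> \<Union>V = S"
  by (simp add: nc_pairings_def partition_on_def)

lemma nc_pairings_noncrossing:
  assumes "V \<in> nc_pairings S" "{a, b} \<in> V" "{c, d} \<in> V" "a < c" "c < b" "b < d"
  shows False
proof -
  have "Min {a, b} = a" "Max {a, b} = b" "Min {c, d} = c" "Max {c, d} = d" using assms by auto
  then show False using assms unfolding nc_pairings_def by (smt (verit) mem_Collect_eq)
qed

lemma nc_pairingsI: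
  assumes "partition_on S V" "\<And>B. B \<in> V \<Longrightarrow> card B = 2"
    and "\<And>a b c d. {a, b} \<in> V \<Longrightarrow> {c, d} \<in> V \<Longrightarrow> a < c \<Longrightarrow> c < b \<Longrightarrow> b < d \<Longrightarrow> False"
  shows "V \<in> nc_pairings S"
proof -
  have False if BC: "B \<in> V" "C \<in> V" and "Min B < Min C" "Min C < Max B" "Max B < Max C" for B C
  proof -
    obtain a b where "B = {a, b}" "Min B = a" "Max B = b" using assms(2)[OF BC(1)] card_2_natE by metis
    moreover obtain c d where "C = {c, d}" "Min C = c" "Max C = d"
      using assms(2)[OF BC(2)] card_2_natE by metis
    ultimately show False using assms(3)[of a b c d] that by simp
  qed
  then show ?thesis unfolding nc_pairings_def using assms(1,2) by blast
qed

lemma nc_pairings_finite: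
  assumes "V \<in> nc_pairings S" "finite S" shows "finite V"
  using nc_pairings_partition[OF assms(1)] assms(2) by (metis finite_elements)

lemma finite_nc_pairings:
  assumes "finite S" shows "finite (nc_pairings S)"
proof (rule finite_subset)
  show "nc_pairings S \<subseteq> Pow (Pow S)" by (auto dest: nc_pairings_Union)
qed (use assms in simp)

lemma nc_pairings_card:
  assumes "V \<in> nc_pairings S" "finite S" shows "card S = 2 * card V"
proof -
  have "card (\<Union>V) = (\<Sum>B\<in>V. card B)"
    using nc_pairings_partition[OF assms(1)] nc_pairings_pairs[OF assms(1)]
    by (intro card_Union_disjoint)
       (auto simp: partition_on_def disjoint_def pairwise_def disjnt_def intro: card_ge_0_finite)
  also have "\<dots> = (\<Sum>B\<in>V. 2)" using nc_pairings_pairs[OF assms(1)] by simp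
  finally show ?thesis using nc_pairings_Union[OF assms(1)] by simp
qed

lemma nc_pairings_partner:
  assumes "V \<in> nc_pairings S" "c \<in> S"
  obtains d where "d \<noteq> c" "{c, d} \<in> V" "d \<in> S"
proof -
  obtain B where B: "B \<in> V" "c \<in> B" using nc_pairings_Union[OF assms(1)] assms(2) by auto
  then obtain d where "B = {c, d}" "d \<noteq> c"
    using nc_pairings_pairs[OF assms(1)] by (metis card_2_iff insertE insert_commute singletonD)
  then show thesis using that B nc_pairings_Union[OF assms(1)] by blast
qed

lemma nc_pairings_remove:
  assumes V: "V \<in> nc_pairings (insert a (insert b S))" and ab: "{a, b} \<in> V"
    and "a \<notin> S" "b \<notin> S"
  shows "V - {{a, b}} \<in> nc_pairings S"
proof (rule nc_pairingsI)
  have "\<Union>(V - {{a, b}}) = S"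
  proof
    show "\<Union>(V - {{a, b}}) \<subseteq> S"
    proof
      fix c assume "c \<in> \<Union>(V - {{a, b}})"
      then obtain B where B: "B \<in> V" "B \<noteq> {a, b}" "c \<in> B" by auto
      then have "c \<noteq> a" "c \<noteq> b" using nc_pairings_disjoint[OF V B(1) ab] by auto
      then show "c \<in> S" using B nc_pairings_Union[OF V] by auto
    qed
    show "S \<subseteq> \<Union>(V - {{a, b}})" using nc_pairings_Union[OF V] assms(3,4) by blast
  qed
  then show "partition_on S (V - {{a, b}})"
    using nc_pairings_partition[OF V] by (auto simp: partition_on_def disjoint_def)
  show "card B = 2" if "B \<in> V - {{a, b}}" for B using that nc_pairings_pairs[OF V] by blast
  fix p q r s assume "{p, q} \<in> V - {{a, b}}" "{r, s} \<in> V - {{a, b}}" "p < r" "r < q" "q < s"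
  then show False using nc_pairings_noncrossing[OF V] by blast
qed

text \<open>No point of \<open>S\<close> lies between \<open>a\<close> and \<open>b\<close>, and a
  crossing with \<open>{a, b}\<close> would need one there.\<close>

lemma nc_pairings_insert:
  assumes V: "V \<in> nc_pairings S" and "a < b" "a \<notin> S" "b \<notin> S" "\<And>c. c \<in> S \<Longrightarrow> c < a \<or> b < c"
  shows "insert {a, b} V \<in> nc_pairings (insert a (insert b S))"
proof (rule nc_pairingsI)
  have VS: "B \<subseteq> S" if "B \<in> V" for B using nc_pairings_Union[OF V] that by auto
  show "partition_on (insert a (insert b S)) (insert {a, b} V)"
  proof (subst partition_on_insert)
    show "disjnt {a, b} (\<Union>V)" using assms(3,4) nc_pairings_Union[OF V] by (auto simp: disjnt_def)
    have "insert a (insert b S) - {a, b} = S" using assms(3,4) by auto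
    then show "partition_on (insert a (insert b S) - {a, b}) V \<and>
        {a, b} \<subseteq> insert a (insert b S) \<and> {a, b} \<noteq> {}"
      using nc_pairings_partition[OF V] by auto
  qed
  show "card B = 2" if "B \<in> insert {a, b} V" for B
    using that nc_pairings_pairs[OF V] assms(2) by auto
  fix p q r s
  assume *: "{p, q} \<in> insert {a, b} V" "{r, s} \<in> insert {a, b} V" "p < r" "r < q" "q < s"
  have out: "c < a \<or> b < c" if "{c, d} \<in> V \<or> {d, c} \<in> V" for c d
    using VS that assms(5) by blast
  consider "{p, q} \<in> V" "{r, s} \<in> V" | "{p, q} = {a, b}" "{r, s} \<in> V"
    | "{p, q} \<in> V" "{r, s} = {a, b}" | "{p, q} = {a, b}" "{r, s} = {a, b}"
    using * by blast
  then show False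
  proof cases
    case 1
    then show False using nc_pairings_noncrossing[OF V] * by blast
  next
    case 2
    then have "p = a" "q = b" using * assms(2) by (auto simp: doubleton_eq_iff)
    then show False using out[of r s] 2 * by auto
  next
    case 3
    then have "r = a" "s = b" using * assms(2) by (auto simp: doubleton_eq_iff)
    then show False using out[of q p] 3 * by auto
  next
    case 4
    then show False using * by (auto simp: doubleton_eq_iff)
  qed
qed

text \<open>Take a block of minimal length. A point strictly inside it would, by non-crossing, have
  its partner inside as well and so yield a shorter block; hence the two points are adjacent in the
  list.\<close>

lemma nc_pairings_adjacent:
  assumes V: "V \<in> nc_pairings (set ts)" and srt: "sorted_wrt (<) ts" and "ts \<noteq> []"
  obtains as a b bs where "ts = as @ a # b # bs" "{a, b} \<in> V"
proof -
  have "V \<noteq> {}" using nc_pairings_Union[OF V] \<open>ts \<noteq> []\<close> by auto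
  then obtain B where B: "B \<in> V" and least: "\<And>C. C \<in> V \<Longrightarrow> Max B - Min B \<le> Max C - Min C"
    using ex_has_least_nat[of "\<lambda>B. B \<in> V" _ "\<lambda>B. Max B - Min B"] by blast
  obtain a b where ab: "B = {a, b}" "a < b" "Min B = a" "Max B = b"
    using nc_pairings_pairs[OF V B] card_2_natE by metis
  have "a \<in> set ts" "b \<in> set ts" using B ab nc_pairings_Union[OF V] by auto
  then obtain as rest where ts: "ts = as @ a # rest" by (meson split_list)
  have "b \<in> set rest" using \<open>b \<in> set ts\<close> srt ab(2) unfolding ts by (auto simp: sorted_wrt_append)
  then obtain c bs where rest: "rest = c # bs" by (cases rest) auto
  have "c = b"
  proof (rule ccontr)
    assume "c \<noteq> b"
    then have c: "a < c" "c < b" "c \<in> set ts"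
      using \<open>b \<in> set rest\<close> srt unfolding ts rest by (auto simp: sorted_wrt_append)
    obtain d where d: "d \<noteq> c" "{c, d} \<in> V" using nc_pairings_partner[OF V c(3)] by metis
    have "d \<noteq> a" "d \<noteq> b"
      using nc_pairings_disjoint[OF V d(2), of B] B ab c by (auto simp: doubleton_eq_iff)
    then consider "d < a" | "b < d" | "a < d" "d < b" by linarith
    then show False
    proof cases
      case 1
      have "{d, c} \<in> V" using d by (simp add: insert_commute)
      then show False using nc_pairings_noncrossing[OF V _ _ 1] B ab c by blast
    next
      case 2
      then show False using nc_pairings_noncrossing[OF V, of a b c d] B ab c d by blast
    next
      case 3
      have "Max {c, d} - Min {c, d} < Max B - Min B"
        using 3 c ab d by (cases "c < d") (auto simp: insert_commute)
      then show False using least[OF d(2)] by simp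
    qed
  qed
  then show thesis using that ts rest B ab by blast
qed

section \<open>Classifying and counting closed walks by the partition of their steps\<close>

lemma kernel_partition_on:
  assumes "distinct (map fst ws)"
  shows "partition_on (fst ` set ws) (kernel_partition x ws)"
  unfolding partition_on_def disjoint_def
proof (intro conjI ballI impI)
  show "\<Union> (kernel_partition x ws) = fst ` set ws"
    unfolding kernel_partition_def etimes_def edges_def fst_tedges[symmetric, of ws x] by force
  show "{} \<notin> kernel_partition x ws"
    unfolding kernel_partition_def etimes_def edges_def by force
  fix A B assume "A \<in> kernel_partition x ws" "B \<in> kernel_partition x ws" "A \<noteq> B"
  then show "A \<inter> B = {}"
    using tedges_functional[OF assms] unfolding kernel_partition_def etimes_def by blast
qed

definition closed_walks :: "nat \<Rightarrow> nat list \<Rightarrow> (nat \<times> (nat \<times> nat) list) set" where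
  "closed_walks N ts = {(x, ws). map fst ws = ts \<and> verts x ws \<subseteq> {..<N} \<and> endpoint x ws = x}"

text \<open>For a pairing \<open>V\<close> of the times the graph of such a walk is connected with
  \<open>length ts div 2\<close> edges and one vertex more: a tree, traversed once around with every
  edge used twice.\<close>

definition tree_walks :: "nat \<Rightarrow> nat list \<Rightarrow> nat set set \<Rightarrow> (nat \<times> (nat \<times> nat) list) set" where
  "tree_walks N ts V = {(x, ws) \<in> closed_walks N ts.
    kernel_partition x ws = V \<and> card (verts x ws) = Suc (length ts div 2)}"

text \<open>\<open>rep\<close> is what a nonzero expectation provides, since an edge used only once
  contributes a centred factor.\<close>

lemma closed_walks_tree_walks:
  assumes "(x, ws) \<in> closed_walks N ts" "sorted_wrt (<) ts"
    and many: "length ts + 2 \<le> 2 * card (verts x ws)"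
    and rep: "\<And>e. e \<in> edges x ws \<Longrightarrow> card (etimes x ws e) \<noteq> 1"
  shows "kernel_partition x ws \<in> nc_pairings (set ts)"
    and "(x, ws) \<in> tree_walks N ts (kernel_partition x ws)"
proof -
  have ts: "map fst ws = ts" and cl: "endpoint x ws = x"
    using assms(1) by (auto simp: closed_walks_def)
  then have dist: "distinct (map fst ws)" and len: "length ws = length ts"
    using assms(2) by (auto simp: strict_sorted_iff)
  have ge2: "card (etimes x ws e) \<ge> 2" if "e \<in> edges x ws" for e
  proof -
    have "etimes x ws e \<noteq> {}" using that by (auto simp: etimes_def edges_iff)
    then have "card (etimes x ws e) \<noteq> 0" by simp
    then show ?thesis using rep[OF that] by linarith
  qed
  have sum: "(\<Sum>e\<in>edges x ws. card (etimes x ws e)) = length ts"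
    using sum_card_etimes[OF dist] len by simp
  have "2 * card (edges x ws) \<le> length ts"
    using sum_mono[of "edges x ws" "\<lambda>_. 2" "\<lambda>e. card (etimes x ws e)"] ge2 sum by simp
  \<comment> \<open>Both \<open>2 * card (edges x ws) \<le> length ts\<close> and the bound of the
    vertices by the edges must be equalities, because \<open>many\<close> leaves no slack.\<close>
  then have E: "2 * card (edges x ws) = length ts"
    and C: "2 * card (verts x ws) = length ts + 2"
    using many card_verts_le[of x ws] by linarith+
  have two: "card (etimes x ws e) = 2" if "e \<in> edges x ws" for e
  proof (rule ccontr)
    assume "card (etimes x ws e) \<noteq> 2"
    then have "2 < card (etimes x ws e)" using ge2[OF that] by simp
    then have "(\<Sum>e\<in>edges x ws. 2) < (\<Sum>e\<in>edges x ws. card (etimes x ws e))"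
      using that by (intro sum_strict_mono_ex1 finite_edges ballI ge2 bexI[of _ e])
    then show False using sum E by simp
  qed
  show "kernel_partition x ws \<in> nc_pairings (set ts)"
  proof (rule nc_pairingsI)
    show "partition_on (set ts) (kernel_partition x ws)"
      using kernel_partition_on[OF dist] ts by (metis list.set_map)
    show "card B = 2" if "B \<in> kernel_partition x ws" for B
      using that two by (auto simp: kernel_partition_def)
    fix a b c d
    assume "{a, b} \<in> kernel_partition x ws" "{c, d} \<in> kernel_partition x ws"
      and lt: "a < c" "c < b" "b < d"
    then obtain e e' where "e \<in> edges x ws" "e' \<in> edges x ws"
      "{a, b} = etimes x ws e" "{c, d} = etimes x ws e'"
      unfolding kernel_partition_def by blast
    then show False
      using noncrossing_of_many_vertices[OF cl, of e e' a b c d] two lt many assms(2) ts len by auto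
  qed
  show "(x, ws) \<in> tree_walks N ts (kernel_partition x ws)"
    using assms(1) C by (auto simp: tree_walks_def)
qed

text \<open>A pairing has a block of two adjacent times; removing it matches a walk for
  \<open>V\<close> with a walk for the smaller pairing together with a vertex not yet visited. The
  smaller walk occupies \<open>Suc (card V')\<close> vertices, which gives the next factor.
  Truncated subtraction makes the product zero when there are too few vertices, as it
  should.\<close>

lemma card_tree_walks:
  assumes "V \<in> nc_pairings (set ts)" "sorted_wrt (<) ts"
  shows "card (tree_walks N ts V) = (\<Prod>i<Suc (length ts div 2). N - i)"
    and "finite (tree_walks N ts V)"
proof -
  have "finite (tree_walks N ts V) \<and> card (tree_walks N ts V) = (\<Prod>i<Suc (length ts div 2). N - i)"
    using assms
  proof (induction "length ts" arbitrary: ts V rule: less_induct)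
    case less
    note V = less.prems(1) and srt = less.prems(2)
    show ?case
    proof (cases "ts = []")
      case True
      then have "V = {}" using nc_pairings_Union[OF V] nc_pairings_pairs[OF V] by fastforce
      have "tree_walks N [] {} = (\<lambda>x. (x, [])) ` {..<N}"
        by (auto simp: tree_walks_def closed_walks_def verts_def kernel_partition_def edges_def)
      then show ?thesis using True \<open>V = {}\<close> by (simp add: card_image inj_on_def)
    next
      case False
      obtain as a b bs where ts: "ts = as @ a # b # bs" and ab: "{a, b} \<in> V"
        using nc_pairings_adjacent[OF V srt False] by metis
      have sep: "c < a \<or> b < c" if "c \<in> set (as @ bs)" for c
        using srt that unfolding ts by (auto simp: sorted_wrt_append)
      have "a < b" using srt unfolding ts by (auto simp: sorted_wrt_append)
      have ins: "set ts = insert a (insert b (set (as @ bs)))" unfolding ts by auto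
      have nin: "a \<notin> set (as @ bs)" "b \<notin> set (as @ bs)" using sep \<open>a < b\<close> by force+
      define V' where "V' = V - {{a, b}}"
      have V': "V' \<in> nc_pairings (set (as @ bs))"
        unfolding V'_def using nc_pairings_remove[OF _ ab nin] V ins by simp
      have "V = insert {a, b} V'" using ab V'_def by auto
      have srt': "sorted_wrt (<) (as @ bs)" using srt unfolding ts by (auto simp: sorted_wrt_append)
      define G where "G = tree_walks N (as @ bs) V'"
      have IH: "finite G" "card G = (\<Prod>i<Suc (length (as @ bs) div 2). N - i)"
        using less.hyps[OF _ V' srt'] unfolding G_def ts by auto
      \<comment> \<open>\<open>ext\<close> inserts the excursion to \<open>v\<close> and back, at
        the times \<open>a\<close> and \<open>b\<close>, after the first \<open>length as\<close>
        steps.\<close>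
      define ext where "ext = (\<lambda>((x, ws), v). (x, take (length as) ws @
        (a, v) # (b, endpoint x (take (length as) ws)) # drop (length as) ws))"
      have ext: "ext ((x, us @ ws), v) = (x, us @ (a, v) # (b, endpoint x us) # ws)"
        if "length us = length as" for x us ws v
        using that by (simp add: ext_def)
      have elen: "length (as @ bs) div 2 = card V'" "length ts div 2 = Suc (card V')"
        using nc_pairings_card[OF V'] srt' distinct_card[of "as @ bs"] unfolding ts
        by (auto simp: strict_sorted_iff)
      have map_split: "\<exists>us vs. ws = us @ vs \<and> map fst us = as \<and> map fst vs = bs"
        if "map fst ws = as @ bs" for ws :: "(nat \<times> nat) list" and as bs
        using that by (auto simp: map_eq_append_conv)
      have split: "\<exists>us vs. ws = us @ vs \<and> map fst us = as \<and> map fst vs = bs"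
        if "(x, ws) \<in> G" for x ws
        using that map_split unfolding G_def tree_walks_def closed_walks_def by blast
      have bij: "bij_betw ext (SIGMA p:G. {..<N} - verts (fst p) (snd p)) (tree_walks N ts V)"
        unfolding bij_betw_def
      proof (intro conjI subset_antisym subsetI)
        show "inj_on ext (SIGMA p:G. {..<N} - verts (fst p) (snd p))"
        proof (rule inj_onI)
          fix p q assume pq: "p \<in> (SIGMA p:G. {..<N} - verts (fst p) (snd p))"
            "q \<in> (SIGMA p:G. {..<N} - verts (fst p) (snd p))" "ext p = ext q"
          obtain x ws v y zs w where p: "p = ((x, ws), v)" and q: "q = ((y, zs), w)" by (metis surj_pair)
          obtain us vs where u: "ws = us @ vs" "map fst us = as" using pq(1) p split by blast
          obtain us' vs' where u': "zs = us' @ vs'" "map fst us' = as" using pq(2) q split by blast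
          have "length us = length as" "length us' = length as" using u(2) u'(2) by (metis length_map)+
          then show "p = q" using pq(3) p q u u' by (simp add: ext)
        qed
      next
        fix r assume "r \<in> ext ` (SIGMA p:G. {..<N} - verts (fst p) (snd p))"
        then obtain x ws v where r: "r = ext ((x, ws), v)" and G: "(x, ws) \<in> G"
          and v: "v < N" "v \<notin> verts x ws" by force
        obtain us vs where u: "ws = us @ vs" "map fst us = as" "map fst vs = bs" using G split by blast
        have "length us = length as" using u(2) by (metis length_map)
        then have r': "r = (x, us @ (a, v) # (b, endpoint x us) # vs)" using r u ext by simp
        have vv: "v \<notin> verts x (us @ vs)" using v u by simp
        show "r \<in> tree_walks N ts V"
          using G v u unfolding r' tree_walks_def closed_walks_def G_def ts
          by (simp add: verts_spike kernel_partition_spike[OF vv] \<open>V = insert {a, b} V'\<close>)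
      next
        fix r assume r: "r \<in> tree_walks N ts V"
        obtain x w where rx: "r = (x, w)" by fastforce
        have w: "map fst w = ts" "verts x w \<subseteq> {..<N}" "endpoint x w = x" "kernel_partition x w = V"
          "card (verts x w) = Suc (length ts div 2)"
          using r unfolding rx tree_walks_def closed_walks_def by auto
        have dist: "distinct (map fst w)" using srt w by (simp add: strict_sorted_iff)
        obtain us v y vs where us: "w = us @ (a, v) # (b, y) # vs" "map fst us = as" "map fst vs = bs"
          using w(1) unfolding ts by (auto simp: map_eq_append_conv map_eq_Cons_conv)
        define c where "c = endpoint x us"
        have tes: "(a, uedge c v) \<in> tedges x w" "(b, uedge v y) \<in> tedges x w"
          unfolding us c_def by auto
        obtain e where "etimes x w e = {a, b}"
          using ab w(4) unfolding kernel_partition_def by blast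
        then have "(a, e) \<in> tedges x w" "(b, e) \<in> tedges x w" by (auto simp: etimes_def)
        then have "e = uedge c v" "e = uedge v y" using tes tedges_functional[OF dist] by metis+
        \<comment> \<open>The times \<open>a\<close> and \<open>b\<close> form one block, so both
          steps use one undirected edge and the second one has to return to where the first one
          started.\<close>
        then have "y = c" by (auto simp: uedge_eq_iff)
        have w': "w = us @ (a, v) # (b, endpoint x us) # vs" using us \<open>y = c\<close> c_def by simp
        have "e \<notin> edges x (us @ vs)"
        proof
          assume "e \<in> edges x (us @ vs)"
          then obtain t where t: "(t, e) \<in> tedges x (us @ vs)" unfolding edges_iff by blast
          then have "t \<in> etimes x w e" unfolding w' etimes_def tedges_spike by simp
          moreover have "t \<in> set (map fst (us @ vs))" using tedges_fst[OF t] by (metis list.set_map)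
          then have "t \<in> set (as @ bs)" using us by simp
          ultimately show False using nin \<open>etimes x w e = {a, b}\<close> by auto
        qed
        moreover have "edges x w = insert e (edges x (us @ vs))"
          using edges_spike[of x us a v b vs] \<open>e = uedge c v\<close> unfolding w' c_def by simp
        moreover have "card (edges x w) = card V"
          using card_image[OF inj_on_etimes[OF dist, of x]] w(4) unfolding kernel_partition_def by metis
        moreover have "card V = Suc (card V')"
          using \<open>V = insert {a, b} V'\<close> V'_def nc_pairings_finite[OF V'] by (metis List.finite_set card.insert Diff_iff singletonI)
        ultimately have "card (edges x (us @ vs)) = card V'" by simp
        \<comment> \<open>This is what makes \<open>v\<close> new: the rest has
          \<open>card V'\<close> edges and so at most \<open>card V' + 1\<close> vertices, while the
          whole walk has \<open>card V' + 2\<close>.\<close>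
        then have le: "card (verts x (us @ vs)) \<le> Suc (card V')" using card_verts_le[of x "us @ vs"] by simp
        have vw: "verts x w = insert v (verts x (us @ vs))" unfolding w' verts_spike ..
        have new: "v \<notin> verts x (us @ vs)"
        proof
          assume "v \<in> verts x (us @ vs)"
          then show False using le w(5) vw elen by (simp add: insert_absorb)
        qed
        have cv: "card (verts x (us @ vs)) = Suc (card V')" using w(5) vw new elen by simp
        have kp: "V = insert {a, b} (kernel_partition x (us @ vs))"
          using kernel_partition_spike[OF new, of a b] w(4) w' by simp
        have "{a, b} \<notin> kernel_partition x (us @ vs)"
        proof
          assume "{a, b} \<in> kernel_partition x (us @ vs)"
          then obtain f where "a \<in> etimes x (us @ vs) f" unfolding kernel_partition_def by blast
          then have "(a, f) \<in> tedges x (us @ vs)" by (simp add: etimes_def)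
          then have "a \<in> set (as @ bs)" using tedges_fst us by fastforce
          then show False using nin by simp
        qed
        then have "kernel_partition x (us @ vs) = V'" unfolding V'_def using kp by auto
        moreover have "endpoint x (us @ vs) = x" using w(3) w' by simp
        ultimately have "(x, us @ vs) \<in> G"
          using us w(2) vw cv elen unfolding G_def tree_walks_def closed_walks_def by auto
        moreover have "v \<in> {..<N} - verts x (us @ vs)" using new w(2) vw by auto
        moreover have "r = ext ((x, us @ vs), v)"
          using ext[of us x vs v] us(2) w' rx by (metis length_map)
        ultimately show "r \<in> ext ` (SIGMA p:G. {..<N} - verts (fst p) (snd p))" by force
      qed
      have fin: "finite (SIGMA p:G. {..<N} - verts (fst p) (snd p))" using IH by auto
      have cardS: "card ({..<N} - verts (fst p) (snd p)) = N - Suc (card V')" if "p \<in> G" for p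
        using that elen unfolding G_def tree_walks_def closed_walks_def
        by (auto simp: card_Diff_subset)
      have "card (tree_walks N ts V) = card (SIGMA p:G. {..<N} - verts (fst p) (snd p))"
        using bij_betw_same_card[OF bij] by simp
      also have "\<dots> = card G * (N - Suc (card V'))"
        using cardS IH by (simp add: card_SigmaI)
      also have "\<dots> = (\<Prod>i<Suc (length ts div 2). N - i)"
        unfolding IH elen by simp
      finally show ?thesis using bij_betw_finite[OF bij] fin by blast
    qed
  qed
  then show "card (tree_walks N ts V) = (\<Prod>i<Suc (length ts div 2). N - i)"
    "finite (tree_walks N ts V)" by auto
qed

text \<open>For the count, a walk with at most \<open>r\<close> vertices is encoded by a list of
  \<open>r\<close> vertices containing all of them, and by \<open>length ts + 1\<close> positions in
  this list, one for each vertex that the walk passes.\<close>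

lemma card_closed_walks_le:
  "finite (closed_walks N ts)"
  "N \<ge> 1 \<Longrightarrow> card {(x, ws) \<in> closed_walks N ts. card (verts x ws) \<le> r} \<le> N ^ r * r ^ Suc (length ts)"
proof -
  define f where "f = (\<lambda>xs :: nat list. (hd xs, zip ts (tl xs)))"
  have f: "(x, ws) = f (x # map snd ws)" "length (x # map snd ws) = Suc (length ts)"
    "set (x # map snd ws) = verts x ws"
    if "(x, ws) \<in> closed_walks N ts" for x ws
    using that by (auto simp: closed_walks_def f_def verts_def zip_map_fst_snd)
  have sub: "closed_walks N ts \<subseteq> f ` {xs. set xs \<subseteq> {..<N} \<and> length xs = Suc (length ts)}"
  proof
    fix p assume p: "p \<in> closed_walks N ts"
    obtain x ws where px: "p = (x, ws)" by fastforce
    then have "verts x ws \<subseteq> {..<N}" using p by (auto simp: closed_walks_def)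
    then show "p \<in> f ` {xs. set xs \<subseteq> {..<N} \<and> length xs = Suc (length ts)}"
      using f[of x ws] p px by (intro image_eqI[of _ _ "x # map snd ws"]) auto
  qed
  then show fin: "finite (closed_walks N ts)"
    by (rule finite_subset) (simp add: finite_lists_length_eq)
  assume "N \<ge> 1"
  let ?Y = "{ys. set ys \<subseteq> {..<N} \<and> length ys = r}"
  let ?I = "{ps. set ps \<subseteq> {..<r} \<and> length ps = Suc (length ts)}"
  have "{(x, ws) \<in> closed_walks N ts. card (verts x ws) \<le> r}
      \<subseteq> (\<lambda>(ys, ps). f (map ((!) ys) ps)) ` (?Y \<times> ?I)"
  proof
    fix p assume p: "p \<in> {(x, ws) \<in> closed_walks N ts. card (verts x ws) \<le> r}"
    obtain x ws where px: "p = (x, ws)" by fastforce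
    then have cw: "(x, ws) \<in> closed_walks N ts" and r: "card (verts x ws) \<le> r" using p by auto
    have vN: "verts x ws \<subseteq> {..<N}" using cw by (auto simp: closed_walks_def)
    \<comment> \<open>Fewer than \<open>r\<close> vertices are padded with 0, which is a legitimate
      vertex because \<open>N \<ge> 1\<close>.\<close>
    define ys where "ys = sorted_list_of_set (verts x ws) @ replicate (r - card (verts x ws)) 0"
    have ys: "ys \<in> ?Y" using r vN \<open>N \<ge> 1\<close> by (auto simp: ys_def)
    have lys: "length ys = r" using ys by simp
    have "\<exists>i<r. ys ! i = v" if "v \<in> verts x ws" for v
    proof -
      have "v \<in> set ys" using that by (simp add: ys_def)
      then show ?thesis unfolding in_set_conv_nth lys .
    qed
    then have "\<forall>v\<in>verts x ws. \<exists>i. i < r \<and> ys ! i = v" by blast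
    then obtain g where g: "\<forall>v\<in>verts x ws. g v < r \<and> ys ! g v = v"
      unfolding bchoice_iff by blast
    define ps where "ps = map g (x # map snd ws)"
    have "ps \<in> ?I" using g f(2,3)[OF cw] unfolding ps_def by (auto simp: verts_def)
    moreover have "map ((!) ys) ps = x # map snd ws"
      unfolding ps_def map_map using g f(3)[OF cw] by (intro map_idI) auto
    ultimately show "p \<in> (\<lambda>(ys, ps). f (map ((!) ys) ps)) ` (?Y \<times> ?I)"
      using ys f(1)[OF cw] px by (intro image_eqI[of _ _ "(ys, ps)"]) auto
  qed
  then have "card {(x, ws) \<in> closed_walks N ts. card (verts x ws) \<le> r} \<le> card (?Y \<times> ?I)"
    by (intro surj_card_le finite_cartesian_product) (simp_all add: finite_lists_length_eq)
  also have "\<dots> = N ^ r * r ^ Suc (length ts)"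
    by (simp only: card_cartesian_product card_lists_length_eq finite_lessThan card_lessThan)
  finally show "card {(x, ws) \<in> closed_walks N ts. card (verts x ws) \<le> r} \<le> N ^ r * r ^ Suc (length ts)" .
qed

section \<open>The sum over non-crossing pairings\<close>

definition arc_weight :: "real \<Rightarrow> nat set set \<Rightarrow> real" where
  "arc_weight \<rho> V = (\<Prod>B\<in>V. \<rho> ^ (Max B - Min B))"

text \<open>By non-crossing, a point under an arc has its partner under the same arc. So the arcs
  nested in \<open>B\<close> pair up the points strictly between its ends, whose number is then
  twice the number of these arcs.\<close>

lemma nc_pairings_inside:
  assumes V: "V \<in> nc_pairings {l..u}" and B: "B \<in> V"
  shows "{C \<in> V. Min B < Min C \<and> Max C < Max B} \<in> nc_pairings {Min B<..<Max B}" (is "?N \<in> _")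
proof (rule nc_pairingsI)
  obtain a b where ab: "B = {a, b}" "a < b" "Min B = a" "Max B = b"
    using nc_pairings_pairs[OF V B] card_2_natE by metis
  have *: "\<exists>C\<in>?N. c \<in> C" if c: "a < c" "c < b" for c
  proof -
    have "a \<in> {l..u}" "b \<in> {l..u}" using nc_pairings_Union[OF V] B ab by blast+
    then have "c \<in> {l..u}" using c by simp
    then obtain d where d: "d \<noteq> c" "{c, d} \<in> V" using nc_pairings_partner[OF V] by metis
    then have d': "{d, c} \<in> V" by (simp add: insert_commute)
    have "d \<noteq> a" "d \<noteq> b"
      using nc_pairings_disjoint[OF V d(2) B] ab c by (auto simp: doubleton_eq_iff)
    moreover have "\<not> d < a" using nc_pairings_noncrossing[OF V d', of a b] B ab c by blast
    moreover have "\<not> b < d" using nc_pairings_noncrossing[OF V _ d(2), of a b] B ab c by blast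
    ultimately have "{c, d} \<in> ?N" using d c ab by simp
    then show ?thesis by blast
  qed
  have "c \<in> {a<..<b}" if C: "C \<in> ?N" "c \<in> C" for C c
  proof -
    have "finite C" using C nc_pairings_pairs[OF V] by (metis (no_types, lifting) card.infinite mem_Collect_eq zero_neq_numeral)
    then have "Min C \<le> c" "c \<le> Max C" using C by auto
    then show ?thesis using C ab by auto
  qed
  then have "\<Union>?N \<subseteq> {a<..<b}" by blast
  moreover have "c \<in> \<Union>?N" if "c \<in> {a<..<b}" for c using *[of c] that by simp
  ultimately have "\<Union>?N = {a<..<b}" by blast
  then show "partition_on {Min B<..<Max B} ?N"
    using nc_pairings_partition[OF V] ab unfolding partition_on_def pairwise_def by auto
  show "card C = 2" if "C \<in> ?N" for C using that nc_pairings_pairs[OF V] by simp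
  fix p q r s assume "{p, q} \<in> ?N" "{r, s} \<in> ?N" "p < r" "r < q" "q < s"
  then show False using nc_pairings_noncrossing[OF V] by blast
qed

lemma arc_weight_nest:
  assumes "V \<in> NC2 (2 * n)"
  shows "arc_weight \<rho> V = \<rho> ^ n * \<rho> ^ (2 * nest V)"
proof -
  have V: "V \<in> nc_pairings {1..2 * n}" using assms by (simp add: NC2_eq)
  define N where "N B = {C \<in> V. Min B < Min C \<and> Max C < Max B}" for B
  have finV: "finite V" using nc_pairings_finite[OF V] by simp
  have len: "Max B - Min B = Suc (2 * card (N B))" if B: "B \<in> V" for B
  proof -
    have "Min B < Max B" using nc_pairings_pairs[OF V B] card_2_natE by metis
    moreover have "card {Min B<..<Max B} = 2 * card (N B)"
      using nc_pairings_card[OF nc_pairings_inside[OF V B]] unfolding N_def by simp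
    ultimately show ?thesis by simp
  qed
  have "nest V = card (SIGMA B:V. N B)"
  proof -
    have "Min C < Max C" if "C \<in> V" for C using nc_pairings_pairs[OF V that] card_2_natE by metis
    then have "{(B, C). B \<in> V \<and> C \<in> V \<and> Min B < Min C \<and> Min C < Max C \<and> Max C < Max B}
        = (SIGMA B:V. N B)"
      unfolding N_def by auto
    then show ?thesis by (simp add: nest_def)
  qed
  also have "\<dots> = (\<Sum>B\<in>V. card (N B))" using finV by (subst card_SigmaI) (auto simp: N_def)
  finally have nest: "nest V = (\<Sum>B\<in>V. card (N B))" .
  have "card V = n" using nc_pairings_card[OF V] by simp
  then have "(\<Sum>B\<in>V. Max B - Min B) = n + 2 * nest V"
    using nest by (simp add: len sum.distrib sum_Suc sum_distrib_left[symmetric])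
  then show ?thesis unfolding arc_weight_def power_sum[symmetric] by (simp add: power_add)
qed

lemma NC2_odd: "odd m \<Longrightarrow> NC2 m = {}"
  using nc_pairings_card[of _ "{1..m}"] unfolding NC2_eq
  by (metis card_atLeastAtMost diff_Suc_1 dvd_triv_left equals0I finite_atLeastAtMost)

text \<open>The list \<open>os\<close> is the stack of the points whose arcs are still open, the most recent one first.\<close>

definition opener_pairings :: "nat list \<Rightarrow> nat list \<Rightarrow> nat set set set" where
  "opener_pairings os ss =
    {V \<in> nc_pairings (set os \<union> set ss). \<forall>p\<in>set os. \<exists>z>p. {p, z} \<in> V}"

text \<open>Every opener needs a larger partner; with no further points available, the largest
  opener has none.\<close>

lemma opener_pairings_Nil: "opener_pairings os [] = (if os = [] then {{}} else {})"
proof (cases "os = []")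
  case True
  have "V = {}" if "V \<in> nc_pairings {}" for V
    using nc_pairings_Union[OF that] nc_pairings_pairs[OF that] by fastforce
  moreover have "{} \<in> nc_pairings {}" by (auto simp: nc_pairings_def partition_on_def)
  ultimately show ?thesis using True by (auto simp: opener_pairings_def)
next
  case False
  have "V \<notin> opener_pairings os []" for V
  proof
    assume V: "V \<in> opener_pairings os []"
    have m: "Max (set os) \<in> set os" using False by simp
    then obtain z where z: "z > Max (set os)" "{Max (set os), z} \<in> V"
      using V unfolding opener_pairings_def by blast
    then have "z \<in> set os" using V nc_pairings_Union[of V "set os"] by (auto simp: opener_pairings_def)
    then have "z \<le> Max (set os)" by simp
    then show False using z by simp
  qed
  then show ?thesis using False by auto
qed

text \<open>A closing point can only close the top of the stack: if \<open>q\<close> lay below the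
  top \<open>p\<close>, then \<open>p\<close>, still open, would have its partner beyond
  \<open>s\<close>, and its arc would cross \<open>{q, s}\<close>.\<close>

lemma opener_pairings_closing:
  assumes V: "V \<in> opener_pairings os (s # ss)"
    and srt: "sorted_wrt (>) os" "sorted_wrt (<) (s # ss)" "\<forall>p\<in>set os. p < s"
    and q: "q < s" "{q, s} \<in> V"
  obtains os' where "os = q # os'" "V - {{q, s}} \<in> opener_pairings os' ss"
proof -
  have nc: "V \<in> nc_pairings (set os \<union> set (s # ss))" using V by (simp add: opener_pairings_def)
  have "q \<in> set os \<union> set (s # ss)" using nc_pairings_Union[OF nc] q by auto
  then have "q \<in> set os" using srt q by auto
  then obtain p os' where os: "os = p # os'" by (cases os) auto
  have "q = p"
  proof (rule ccontr)
    assume "q \<noteq> p"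
    then have "q < p" using \<open>q \<in> set os\<close> os srt by auto
    obtain z where z: "z > p" "{p, z} \<in> V" using V os by (auto simp: opener_pairings_def)
    have "z \<in> set os \<union> set (s # ss)" using nc_pairings_Union[OF nc] z by auto
    then have "z \<ge> s" using z os srt by auto
    moreover have "z \<noteq> s"
    proof
      assume "z = s"
      then have "{p, s} = {q, s}" using nc_pairings_disjoint[OF nc z(2) q(2), of s] by auto
      then show False using \<open>q \<noteq> p\<close> q by (auto simp: doubleton_eq_iff)
    qed
    ultimately show False
      using nc_pairings_noncrossing[OF nc q(2) z(2)] \<open>q < p\<close> os srt(3) by auto
  qed
  have "V - {{q, s}} \<in> nc_pairings (set os' \<union> set ss)"
  proof (rule nc_pairings_remove)
    show "V \<in> nc_pairings (insert q (insert s (set os' \<union> set ss)))"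
      using nc os \<open>q = p\<close> by (simp add: insert_commute)
  qed (use q os \<open>q = p\<close> srt in auto)
  moreover have "\<exists>z>r. {r, z} \<in> V - {{q, s}}" if r: "r \<in> set os'" for r
  proof -
    have "\<exists>z>r. {r, z} \<in> V" using V os r by (auto simp: opener_pairings_def)
    then obtain z where "z > r" "{r, z} \<in> V" by blast
    moreover have "r \<noteq> q" "r \<noteq> s" using r os \<open>q = p\<close> srt by auto
    ultimately show ?thesis by (auto simp: doubleton_eq_iff)
  qed
  ultimately show thesis using that os \<open>q = p\<close> by (simp add: opener_pairings_def)
qed

lemma opener_pairings_close:
  assumes V: "V \<in> opener_pairings os ss"
    and srt: "sorted_wrt (>) (p # os)" "sorted_wrt (<) (s # ss)" "\<forall>q\<in>set (p # os). q < s"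
  shows "insert {p, s} V \<in> opener_pairings (p # os) (s # ss)" "{p, s} \<notin> V"
proof -
  have nc: "V \<in> nc_pairings (set os \<union> set ss)" using V by (simp add: opener_pairings_def)
  have nin: "p \<notin> set os \<union> set ss" "s \<notin> set os \<union> set ss" using srt by auto
  have "insert {p, s} V \<in> nc_pairings (insert p (insert s (set os \<union> set ss)))"
    using nin srt by (intro nc_pairings_insert[OF nc]) auto
  then show "insert {p, s} V \<in> opener_pairings (p # os) (s # ss)"
    using V srt by (auto simp: opener_pairings_def insert_commute)
  show "{p, s} \<notin> V" using nc_pairings_Union[OF nc] nin by auto
qed

lemma finite_opener_pairings: "finite (opener_pairings os ss)"
  unfolding opener_pairings_def by (rule finite_Collect_conjI) (simp add: finite_nc_pairings)

definition opener_sum :: "real \<Rightarrow> nat list \<Rightarrow> nat list \<Rightarrow> real" where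
  "opener_sum \<rho> os ss = (\<Sum>V\<in>opener_pairings os ss. arc_weight \<rho> V)"

lemma opener_sum_Nil: "opener_sum \<rho> os [] = (if os = [] then 1 else 0)"
  by (simp add: opener_sum_def opener_pairings_Nil arc_weight_def)

text \<open>The next point \<open>s\<close> either opens a new arc or closes the most recently opened one.\<close>

lemma opener_sum_Cons:
  assumes srt: "sorted_wrt (>) os" "sorted_wrt (<) (s # ss)" "\<forall>p\<in>set os. p < s"
  shows "opener_sum \<rho> os (s # ss) = opener_sum \<rho> (s # os) ss +
    (case os of [] \<Rightarrow> 0 | p # os' \<Rightarrow> \<rho> ^ (s - p) * opener_sum \<rho> os' ss)"
proof -
  define A where "A = {V \<in> opener_pairings os (s # ss). \<exists>z>s. {s, z} \<in> V}"
  define B where "B = {V \<in> opener_pairings os (s # ss). \<exists>q<s. {q, s} \<in> V}"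
  have AB: "opener_pairings os (s # ss) = A \<union> B"
  proof -
    have "V \<in> A \<union> B" if V: "V \<in> opener_pairings os (s # ss)" for V
    proof -
      have nc: "V \<in> nc_pairings (set os \<union> set (s # ss))" using V by (simp add: opener_pairings_def)
      obtain d where d: "d \<noteq> s" "{s, d} \<in> V" using nc_pairings_partner[OF nc, of s] by auto
      then have "{d, s} \<in> V" by (simp add: insert_commute)
      then show ?thesis using d V unfolding A_def B_def by (cases "s < d") auto
    qed
    then show ?thesis by (auto simp: A_def B_def)
  qed
  have "A \<inter> B = {}"
  proof -
    have False if VAB: "V \<in> A" "V \<in> B" for V
    proof -
      have nc: "V \<in> nc_pairings (set os \<union> set (s # ss))" using VAB by (simp add: A_def opener_pairings_def)
      obtain z q where zq: "z > s" "{s, z} \<in> V" "q < s" "{q, s} \<in> V" using VAB unfolding A_def B_def by blast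
      then have "{s, z} = {q, s}" using nc_pairings_disjoint[OF nc zq(2) zq(4), of s] by auto
      then show False using zq by (auto simp: doubleton_eq_iff)
    qed
    then show ?thesis by blast
  qed
  have "finite A" "finite B" using finite_opener_pairings AB by (metis finite_Un)+
  have A_eq: "A = opener_pairings (s # os) ss" unfolding A_def opener_pairings_def by auto
  have "(\<Sum>V\<in>B. arc_weight \<rho> V)
      = (case os of [] \<Rightarrow> 0 | p # os' \<Rightarrow> \<rho> ^ (s - p) * opener_sum \<rho> os' ss)"
  proof (cases os)
    case Nil
    have "B = {}" unfolding B_def using opener_pairings_closing[OF _ srt] Nil by blast
    then show ?thesis using Nil by simp
  next
    case (Cons p os')
    have srt': "sorted_wrt (>) (p # os')" "\<forall>q\<in>set (p # os'). q < s" using srt Cons by auto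
    have "B = insert {p, s} ` opener_pairings os' ss"
    proof (intro equalityI subsetI)
      fix V assume "V \<in> B"
      then obtain q where q: "V \<in> opener_pairings os (s # ss)" "q < s" "{q, s} \<in> V" by (auto simp: B_def)
      obtain os'' where "os = q # os''" "V - {{q, s}} \<in> opener_pairings os'' ss"
        using opener_pairings_closing[OF q(1) srt q(2,3)] by blast
      then show "V \<in> insert {p, s} ` opener_pairings os' ss"
        using Cons q(3) by (intro image_eqI[of _ _ "V - {{q, s}}"]) auto
    next
      fix V assume "V \<in> insert {p, s} ` opener_pairings os' ss"
      then show "V \<in> B"
        using opener_pairings_close[OF _ srt'(1) srt(2) srt'(2)] srt'(2) Cons unfolding B_def by force
    qed
    moreover have "inj_on (insert {p, s}) (opener_pairings os' ss)"
      using opener_pairings_close(2)[OF _ srt'(1) srt(2) srt'(2)] by (intro inj_onI) (metis insert_ident)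
    ultimately have "(\<Sum>V\<in>B. arc_weight \<rho> V)
        = (\<Sum>V\<in>opener_pairings os' ss. arc_weight \<rho> (insert {p, s} V))"
      by (simp add: sum.reindex)
    also have "\<dots> = (\<Sum>V\<in>opener_pairings os' ss. \<rho> ^ (s - p) * arc_weight \<rho> V)"
    proof (rule sum.cong[OF refl])
      fix V assume V: "V \<in> opener_pairings os' ss"
      then have "finite V" by (auto simp: opener_pairings_def intro: nc_pairings_finite)
      then show "arc_weight \<rho> (insert {p, s} V) = \<rho> ^ (s - p) * arc_weight \<rho> V"
        using opener_pairings_close(2)[OF V srt'(1) srt(2) srt'(2)] srt'(2)
        by (simp add: arc_weight_def)
    qed
    finally show ?thesis using Cons by (simp add: opener_sum_def sum_distrib_left)
  qed
  then show ?thesis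
    unfolding opener_sum_def AB using \<open>A \<inter> B = {}\<close> \<open>finite A\<close> \<open>finite B\<close>
    by (simp add: sum.union_disjoint A_eq[symmetric])
qed

text \<open>The weighted number of Dyck paths with \<open>n\<close> steps from height
  \<open>k\<close> to height 0: an up step has weight 1, the down step from \<open>k + 1\<close> to
  \<open>k\<close> has weight \<open>\<rho> ^ (2 * k + 1)\<close>. These are the weights of creation
  and annihilation for \<open>t = \<rho>\<^sup>2\<close> and
  \<open>norm h = sqrt \<rho>\<close>.\<close>

fun dyck_sum :: "real \<Rightarrow> nat \<Rightarrow> nat \<Rightarrow> real" where
  "dyck_sum \<rho> 0 k = (if k = 0 then 1 else 0)"
| "dyck_sum \<rho> (Suc n) 0 = dyck_sum \<rho> n 1"
| "dyck_sum \<rho> (Suc n) (Suc k) = dyck_sum \<rho> n (Suc (Suc k)) + (\<rho>\<^sup>2) ^ k * \<rho> * dyck_sum \<rho> n k"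

lemma prod_list_power_Suc:
  assumes "\<forall>p\<in>set os. p < s"
  shows "(\<Prod>p\<leftarrow>os. \<rho> ^ (Suc s - p)) = \<rho> ^ length os * (\<Prod>p\<leftarrow>os. (\<rho> :: real) ^ (s - p))"
  using assms by (induction os) (auto simp: Suc_diff_le less_imp_le)

text \<open>The two sides charge the same total at different moments. For pairings, each unit of
  time costs one factor \<rho> per open arc; the product over \<open>os\<close> is what the open
  arcs have accumulated before \<open>s\<close>. For Dyck paths the step up to height
  \<open>j\<close> is free and its cost \<open>\<rho> ^ j\<close> is collected at the step down from
  \<open>j\<close>. With \<open>k\<close> arcs open the outstanding amount is 1 + 2 + ... + k, which
  is the binomial exponent on the left.\<close>

lemma opener_sum_dyck_sum:
  assumes "\<rho> \<noteq> 0" "sorted_wrt (>) os" "\<forall>p\<in>set os. p < s"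
  shows "opener_sum \<rho> os [s..<s + n] * \<rho> ^ (Suc (length os) choose 2)
    = (\<Prod>p\<leftarrow>os. \<rho> ^ (s - p)) * dyck_sum \<rho> n (length os)"
  using assms(2,3)
proof (induction n arbitrary: s os)
  case 0
  then show ?case by (simp add: opener_sum_Nil numeral_2_eq_2)
next
  case (Suc n)
  let ?P = "\<lambda>os. (\<Prod>p\<leftarrow>os. \<rho> ^ (s - p))"
  have lt: "\<forall>p\<in>set os. p < Suc s" using Suc.prems by auto
  have upt: "[s..<s + Suc n] = s # [Suc s..<Suc s + n]" by (simp add: upt_rec)
  have srt: "sorted_wrt (<) (s # [Suc s..<Suc s + n])" by (simp add: upt[symmetric] del: upt.simps)
  have "opener_sum \<rho> (s # os) [Suc s..<Suc s + n] * \<rho> ^ (Suc (Suc (length os)) choose 2)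
      = \<rho> ^ Suc (length os) * ?P os * dyck_sum \<rho> n (Suc (length os))"
    using Suc.IH[of "s # os" "Suc s"] Suc.prems lt prod_list_power_Suc[OF Suc.prems(2), of \<rho>] by simp
  \<comment> \<open>Opening: from \<open>s\<close> to \<open>s + 1\<close> all
    \<open>length os + 1\<close> open arcs grow by one, and this power of \<rho> is exactly the
    increase of the normalization, so it cancels.\<close>
  moreover have "(Suc (Suc (length os)) choose 2) = Suc (length os) + (Suc (length os) choose 2)"
    by (simp add: numeral_2_eq_2)
  ultimately have 1: "opener_sum \<rho> (s # os) [Suc s..<Suc s + n] * \<rho> ^ (Suc (length os) choose 2)
      = ?P os * dyck_sum \<rho> n (Suc (length os))"
    using assms(1) by (simp add: power_add)
  show ?case
  proof (cases os)
    case Nil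
    then show ?thesis
      using 1 opener_sum_Cons[OF Suc.prems(1) srt Suc.prems(2), of \<rho>] unfolding upt by simp
  next
    case (Cons p os')
    have p: "sorted_wrt (>) os'" "\<forall>q\<in>set os'. q < s" "\<forall>q\<in>set os'. q < Suc s" using Suc.prems lt Cons by auto
    have 2: "opener_sum \<rho> os' [Suc s..<Suc s + n] * \<rho> ^ (Suc (length os') choose 2)
        = \<rho> ^ length os' * ?P os' * dyck_sum \<rho> n (length os')"
      using Suc.IH[OF p(1,3)] prod_list_power_Suc[OF p(2), of \<rho>] by simp
    have c: "(Suc (length os) choose 2) = Suc (length os') + (Suc (length os') choose 2)"
      using Cons by (simp add: numeral_2_eq_2)
    \<comment> \<open>Closing with \<open>j = length os'\<close> arcs remaining: the drop of the
      normalization gives \<open>\<rho> ^ (j + 1)\<close> and the growth of the remaining arcs gives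
      \<open>\<rho> ^ j\<close>, together the weight of the down step.\<close>
    have "\<rho> ^ (s - p) * opener_sum \<rho> os' [Suc s..<Suc s + n] * \<rho> ^ (Suc (length os) choose 2)
       = \<rho> ^ (s - p) * \<rho> ^ Suc (length os') *
         (opener_sum \<rho> os' [Suc s..<Suc s + n] * \<rho> ^ (Suc (length os') choose 2))"
      unfolding c power_add by (simp only: mult_ac)
    also have "\<dots> = ?P os * ((\<rho>\<^sup>2) ^ length os' * \<rho> * dyck_sum \<rho> n (length os'))"
      unfolding 2 using Cons by (simp add: power_mult[symmetric] mult_2 power_add)
    finally have 3: "\<rho> ^ (s - p) * opener_sum \<rho> os' [Suc s..<Suc s + n] * \<rho> ^ (Suc (length os) choose 2)
       = ?P os * ((\<rho>\<^sup>2) ^ length os' * \<rho> * dyck_sum \<rho> n (length os'))" .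
    have "opener_sum \<rho> os [s..<s + Suc n] = opener_sum \<rho> (s # os) [Suc s..<Suc s + n] +
       \<rho> ^ (s - p) * opener_sum \<rho> os' [Suc s..<Suc s + n]"
      unfolding upt opener_sum_Cons[OF Suc.prems(1) srt Suc.prems(2), of \<rho>] using Cons by simp
    then show ?thesis using 1 3 Cons by (simp add: distrib_left distrib_right)
  qed
qed

lemma sum_arc_weight_dyck_sum:
  assumes "\<rho> \<noteq> 0"
  shows "(\<Sum>V\<in>NC2 n. arc_weight \<rho> V) = dyck_sum \<rho> n 0"
proof -
  have "set [1..<1 + n] = {1..n}" by auto
  then have "opener_pairings [] [1..<1 + n] = NC2 n" by (simp add: opener_pairings_def NC2_eq)
  then show ?thesis using opener_sum_dyck_sum[OF assms, of "[]" 1 n]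
    by (simp add: opener_sum_def numeral_2_eq_2)
qed

section \<open>The Fock space\<close>

lemma sum_single_lookup:
  assumes "finite A" "Poly_Mapping.keys p \<subseteq> A"
  shows "(\<Sum>u\<in>A. Poly_Mapping.single u (Poly_Mapping.lookup p u)) = p"
proof (rule poly_mapping_eqI)
  fix k
  have "Poly_Mapping.lookup p k = 0" if "k \<notin> A"
    using that assms(2) by (metis in_keys_iff subsetD)
  then show "Poly_Mapping.lookup (\<Sum>u\<in>A. Poly_Mapping.single u (Poly_Mapping.lookup p u)) k
      = Poly_Mapping.lookup p k"
    using assms(1) by (simp add: lookup_sum lookup_single when_def)
qed

text \<open>Cancellation can make the support of a sum smaller than the union of the supports.
  Additivity is therefore checked over a common finite superset, where the additional terms
  vanish.\<close>

lemma fock_form_superset: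
  assumes "finite A" "Poly_Mapping.keys p \<subseteq> A" "finite B" "Poly_Mapping.keys q \<subseteq> B"
  shows "fock_form t p q = (\<Sum>u\<in>A. \<Sum>v\<in>B.
    cnj (Poly_Mapping.lookup p u) * Poly_Mapping.lookup q v * word_inner t u v)"
proof -
  have "fock_form t p q = (\<Sum>u\<in>Poly_Mapping.keys p. \<Sum>v\<in>B.
    cnj (Poly_Mapping.lookup p u) * Poly_Mapping.lookup q v * word_inner t u v)"
    unfolding fock_form_def using assms(3,4)
    by (intro sum.cong refl sum.mono_neutral_left) (auto simp: in_keys_iff)
  also have "\<dots> = (\<Sum>u\<in>A. \<Sum>v\<in>B.
    cnj (Poly_Mapping.lookup p u) * Poly_Mapping.lookup q v * word_inner t u v)"
    using assms(1,2) by (intro sum.mono_neutral_left) (auto simp: in_keys_iff)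
  finally show ?thesis .
qed

lemma fock_form_add_left: "fock_form t (p + p') q = fock_form t p q + fock_form t p' q"
proof -
  let ?A = "Poly_Mapping.keys p \<union> Poly_Mapping.keys p'" and ?B = "Poly_Mapping.keys q"
  have "fock_form t r q = (\<Sum>u\<in>?A. \<Sum>v\<in>?B.
      cnj (Poly_Mapping.lookup r u) * Poly_Mapping.lookup q v * word_inner t u v)"
    if "r = p + p' \<or> r = p \<or> r = p'" for r
    using that Poly_Mapping.keys_add[of p p'] by (intro fock_form_superset) auto
  then show ?thesis by (simp add: lookup_add sum.distrib algebra_simps)
qed

lemma fock_form_add_right: "fock_form t p (q + q') = fock_form t p q + fock_form t p q'"
proof -
  let ?B = "Poly_Mapping.keys q \<union> Poly_Mapping.keys q'" and ?A = "Poly_Mapping.keys p"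
  have "fock_form t p r = (\<Sum>u\<in>?A. \<Sum>v\<in>?B.
      cnj (Poly_Mapping.lookup p u) * Poly_Mapping.lookup r v * word_inner t u v)"
    if "r = q + q' \<or> r = q \<or> r = q'" for r
    using that Poly_Mapping.keys_add[of q q'] by (intro fock_form_superset) auto
  then show ?thesis by (simp add: lookup_add sum.distrib algebra_simps)
qed

lemma fock_form_zero [simp]: "fock_form t 0 q = 0" "fock_form t p 0 = 0"
  by (simp_all add: fock_form_def)

lemma fock_form_diff_left: "fock_form t (p - p') q = fock_form t p q - fock_form t p' q"
  using fock_form_add_left[of t "p - p'" p' q] by simp

lemma fock_form_diff_right: "fock_form t p (q - q') = fock_form t p q - fock_form t p q'"
  using fock_form_add_right[of t p "q - q'" q'] by simp

lemma fock_form_sum_left: "fock_form t (\<Sum>a\<in>A. f a) q = (\<Sum>a\<in>A. fock_form t (f a) q)"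
  by (induction A rule: infinite_finite_induct) (auto simp: fock_form_add_left)

lemma fock_form_sum_right: "fock_form t p (\<Sum>a\<in>A. f a) = (\<Sum>a\<in>A. fock_form t p (f a))"
  by (induction A rule: infinite_finite_induct) (auto simp: fock_form_add_right)

lemma fock_form_single:
  "fock_form t (Poly_Mapping.single u c) (Poly_Mapping.single v d) = cnj c * d * word_inner t u v"
proof -
  have "Poly_Mapping.keys (Poly_Mapping.single u c) \<subseteq> {u}" "Poly_Mapping.keys (Poly_Mapping.single v d) \<subseteq> {v}"
    by auto
  then show ?thesis
    using fock_form_superset[of "{u}" "Poly_Mapping.single u c" "{v}" "Poly_Mapping.single v d" t]
    by (simp add: lookup_single)
qed

lemma fock_form_sum_single:
  "fock_form t (\<Sum>a\<in>A. Poly_Mapping.single (f a) (c a)) (\<Sum>b\<in>B. Poly_Mapping.single (g b) (d b))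
    = (\<Sum>a\<in>A. \<Sum>b\<in>B. cnj (c a) * d b * word_inner t (f a) (g b))"
  unfolding fock_form_sum_left unfolding fock_form_sum_right fock_form_single ..

lemma fock_form_scale:
  "fock_form t (Poly_Mapping.map ((*) c) p) q = cnj c * fock_form t p q"
  "fock_form t q (Poly_Mapping.map ((*) c) p) = c * fock_form t q p"
proof -
  have l: "Poly_Mapping.lookup (Poly_Mapping.map ((*) c) p) u = c * Poly_Mapping.lookup p u" for u
    by (simp add: Poly_Mapping.map.rep_eq when_def)
  have k: "Poly_Mapping.keys (Poly_Mapping.map ((*) c) p) \<subseteq> Poly_Mapping.keys p"
    by (auto simp: in_keys_iff l)
  show "fock_form t (Poly_Mapping.map ((*) c) p) q = cnj c * fock_form t p q"
    using fock_form_superset[OF _ k _ order_refl, of q t]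
    by (simp add: l fock_form_def sum_distrib_left mult_ac)
  show "fock_form t q (Poly_Mapping.map ((*) c) p) = c * fock_form t q p"
    using fock_form_superset[OF _ order_refl _ k, of q t]
    by (simp add: l fock_form_def sum_distrib_left mult_ac)
qed

lemma hc_inner_commute: "hc_inner v u = cnj (hc_inner u v)"
  by (simp add: hc_inner_def complex_eq_iff inner_commute)

lemma word_inner_commute: "word_inner t v u = cnj (word_inner t u v)"
proof -
  have "(\<Prod>i<n. hc_inner (v ! i) (u ! i)) = cnj (\<Prod>i<n. hc_inner (u ! i) (v ! i))" for n
    unfolding cnj_prod by (intro prod.cong refl hc_inner_commute)
  then show ?thesis by (simp add: word_inner_def)
qed

lemma word_inner_Cons:
  "word_inner t (x # u) (y # v) = complex_of_real (t ^ length u) * hc_inner x y * word_inner t u v"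
  by (simp add: word_inner_def prod.lessThan_Suc_shift numeral_2_eq_2 power_add del: prod.lessThan_Suc)

lemma fock_form_commute: "fock_form t q p = cnj (fock_form t p q)"
proof -
  have "cnj (Poly_Mapping.lookup q u) * Poly_Mapping.lookup p v * word_inner t u v =
      cnj (cnj (Poly_Mapping.lookup p v) * Poly_Mapping.lookup q u * word_inner t v u)" for u v
    using word_inner_commute[of t u v] by (simp add: mult_ac)
  then show ?thesis
    unfolding fock_form_def cnj_sum by (subst sum.swap) (intro sum.cong refl)
qed

text \<open>The real and imaginary parts of the vectors in \<open>X\<close> span a
  finite-dimensional real space. With respect to an orthogonal basis of it, \<open>c b u\<close> is
  the normalized complex coordinate of \<open>u\<close>, and the claim is Parseval's identity: the
  inner product is a finite sum of rank-one kernels.\<close>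

lemma hc_inner_gram:
  fixes X :: "('h :: real_inner \<times> 'h) set"
  assumes "finite X"
  obtains B :: "'h set" and c :: "'h \<Rightarrow> 'h \<times> 'h \<Rightarrow> complex"
  where "finite B" "\<And>u v. u \<in> X \<Longrightarrow> v \<in> X \<Longrightarrow> hc_inner u v = (\<Sum>b\<in>B. cnj (c b u) * c b v)"
proof -
  have "finite (fst ` X \<union> snd ` X)" using assms by simp
  from basis_orthogonal[OF this] obtain B where B: "finite B" "span B = span (fst ` X \<union> snd ` X)"
    "pairwise Linear_Algebra.orthogonal B" by blast
  have inner: "inner x y = (\<Sum>b\<in>B. (inner b x / norm b) * (inner b y / norm b))" if "x \<in> span B" for x y
  proof -
    \<comment> \<open>\<open>r\<close> is the residue of the orthogonal expansion; it lies in the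
      span and is orthogonal to it, hence vanishes. Should \<open>B\<close> contain the zero vector,
      its term is zero since division by zero yields zero.\<close>
    define r where "r = x - (\<Sum>b\<in>B. (inner b x / inner b b) *\<^sub>R b)"
    have "r \<in> span B" unfolding r_def using that by (intro span_diff span_sum span_scale) (auto intro: span_base)
    moreover have "Linear_Algebra.orthogonal r e" if e: "e \<in> B" for e
    proof -
      have "(\<Sum>b\<in>B. (inner b x / inner b b) * inner b e) = (\<Sum>b\<in>B. if b = e then inner e x else 0)"
        using B(3) e by (intro sum.cong refl)
          (auto simp: pairwise_def Linear_Algebra.orthogonal_def)
      also have "\<dots> = inner x e" using B(1) e by (simp add: inner_commute)
      finally show ?thesis
        by (simp add: r_def Linear_Algebra.orthogonal_def inner_diff_left inner_sum_left)
    qed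
    ultimately have "Linear_Algebra.orthogonal r r" using orthogonal_to_span by blast
    then have "x = (\<Sum>b\<in>B. (inner b x / inner b b) *\<^sub>R b)" by (simp add: r_def Linear_Algebra.orthogonal_def)
    then have "inner x y = inner (\<Sum>b\<in>B. (inner b x / inner b b) *\<^sub>R b) y" by (rule arg_cong)
    also have "\<dots> = (\<Sum>b\<in>B. (inner b x / norm b) * (inner b y / norm b))"
      unfolding inner_sum_left inner_scaleR_left
      by (intro sum.cong refl) (simp add: dot_square_norm power2_eq_square)
    finally show ?thesis .
  qed
  define c where "c = (\<lambda>(b :: 'h) u. Complex (inner b (fst u) / norm b) (inner b (snd u) / norm b))"
  have "hc_inner u v = (\<Sum>b\<in>B. cnj (c b u) * c b v)" if "u \<in> X" "v \<in> X" for u v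
  proof -
    have "fst u \<in> span B" "snd u \<in> span B" using that unfolding B(2) by (blast intro: span_base)+
    note i = inner[OF this(1), of "fst v"] inner[OF this(1), of "snd v"]
      inner[OF this(2), of "fst v"] inner[OF this(2), of "snd v"]
    show ?thesis
      unfolding hc_inner_def i by (simp add: c_def complex_eq_iff sum.distrib sum_subtractf)
  qed
  then show thesis using that B(1) by blast
qed

text \<open>The Schur product theorem, one tensor factor at a time: decompose the Gram matrix of the
  first letters into rank-one kernels and absorb these into the coefficients. The words form an
  indexed family and not a set, because distinct words may have equal tails.\<close>

lemma hc_inner_prod_psd:
  fixes f :: "'i \<Rightarrow> ('h :: real_inner \<times> 'h) list"
  assumes "finite A" "\<And>a. a \<in> A \<Longrightarrow> length (f a) = n"
  shows "0 \<le> Re (\<Sum>a\<in>A. \<Sum>b\<in>A. cnj (c a) * c b * (\<Prod>i<n. hc_inner (f a ! i) (f b ! i)))"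
  using assms(2)
proof (induction n arbitrary: f c)
  case 0
  have "(\<Sum>a\<in>A. \<Sum>b\<in>A. cnj (c a) * c b) = cnj (\<Sum>a\<in>A. c a) * (\<Sum>b\<in>A. c b)"
    by (simp add: sum_product)
  also have "\<dots> = complex_of_real ((cmod (\<Sum>a\<in>A. c a))\<^sup>2)"
    by (simp only: complex_norm_square mult.commute)
  finally show ?case by simp
next
  case (Suc n)
  have "finite ((\<lambda>a. f a ! 0) ` A)" using assms(1) by simp
  then obtain B :: "'h set" and g where g: "\<And>u v. u \<in> (\<lambda>a. f a ! 0) ` A \<Longrightarrow> v \<in> (\<lambda>a. f a ! 0) ` A \<Longrightarrow>
      hc_inner u v = (\<Sum>b\<in>B. cnj (g b u) * g b v)"
    by (rule hc_inner_gram) blast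
  have "(\<Sum>a\<in>A. \<Sum>b\<in>A. cnj (c a) * c b * (\<Prod>i<Suc n. hc_inner (f a ! i) (f b ! i)))
    = (\<Sum>a\<in>A. \<Sum>b\<in>A. \<Sum>e\<in>B. cnj (c a * g e (f a ! 0)) * (c b * g e (f b ! 0)) *
        (\<Prod>i<n. hc_inner (tl (f a) ! i) (tl (f b) ! i)))"
  proof (intro sum.cong refl)
    fix a b assume ab: "a \<in> A" "b \<in> A"
    have "(\<Prod>i<Suc n. hc_inner (f a ! i) (f b ! i))
        = hc_inner (f a ! 0) (f b ! 0) * (\<Prod>i<n. hc_inner (f a ! Suc i) (f b ! Suc i))"
      by (rule prod.lessThan_Suc_shift)
    also have "(\<Prod>i<n. hc_inner (f a ! Suc i) (f b ! Suc i))
        = (\<Prod>i<n. hc_inner (tl (f a) ! i) (tl (f b) ! i))"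
      using Suc.prems ab by (intro prod.cong refl) (simp add: nth_tl)
    also have "hc_inner (f a ! 0) (f b ! 0) = (\<Sum>e\<in>B. cnj (g e (f a ! 0)) * g e (f b ! 0))"
      using g ab by blast
    finally show "cnj (c a) * c b * (\<Prod>i<Suc n. hc_inner (f a ! i) (f b ! i))
      = (\<Sum>e\<in>B. cnj (c a * g e (f a ! 0)) * (c b * g e (f b ! 0)) *
        (\<Prod>i<n. hc_inner (tl (f a) ! i) (tl (f b) ! i)))"
      by (simp add: sum_distrib_left sum_distrib_right mult_ac)
  qed
  also have "\<dots> = (\<Sum>e\<in>B. \<Sum>a\<in>A. \<Sum>b\<in>A. cnj (c a * g e (f a ! 0)) * (c b * g e (f b ! 0)) *
        (\<Prod>i<n. hc_inner (tl (f a) ! i) (tl (f b) ! i)))"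
    by (subst (2) sum.swap, subst sum.swap) (rule refl)
  also have "0 \<le> Re \<dots>"
  proof (subst Re_sum, rule sum_nonneg)
    fix e
    show "0 \<le> Re (\<Sum>a\<in>A. \<Sum>b\<in>A. cnj (c a * g e (f a ! 0)) * (c b * g e (f b ! 0)) *
        (\<Prod>i<n. hc_inner (tl (f a) ! i) (tl (f b) ! i)))"
      using Suc.prems by (intro Suc.IH) simp
  qed
  finally show ?case .
qed

lemma Re_mult_of_real: "Re (complex_of_real r * z) = r * Re z"
  by simp

text \<open>Different degrees are orthogonal, so any nonnegative weight per degree preserves
  positivity. The weight is left general because two are needed: that of the form itself, and the
  difference of weights that bounds creation.\<close>

lemma word_weight_psd:
  fixes A :: "('h :: real_inner \<times> 'h) list set"
  assumes "finite A" "\<And>n. w n \<ge> 0"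
  shows "0 \<le> Re (\<Sum>u\<in>A. \<Sum>v\<in>A. cnj (c u) * c v *
    (if length u = length v
     then complex_of_real (w (length u)) * (\<Prod>i<length u. hc_inner (u ! i) (v ! i)) else 0))"
    (is "0 \<le> Re (\<Sum>u\<in>A. \<Sum>v\<in>A. ?k u v)")
proof -
  let ?A = "\<lambda>n. {u \<in> A. length u = n}"
  have "(\<Sum>u\<in>A. \<Sum>v\<in>A. ?k u v) = (\<Sum>n\<in>length ` A. \<Sum>u\<in>?A n. \<Sum>v\<in>A. ?k u v)"
    using assms(1) by (intro sum.group[symmetric]) auto
  also have "\<dots> = (\<Sum>n\<in>length ` A. complex_of_real (w n) *
      (\<Sum>u\<in>?A n. \<Sum>v\<in>?A n. cnj (c u) * c v * (\<Prod>i<n. hc_inner (u ! i) (v ! i))))"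
  proof (rule sum.cong[OF refl])
    fix n
    have "(\<Sum>v\<in>A. ?k u v)
        = (\<Sum>v\<in>?A n. complex_of_real (w n) * (cnj (c u) * c v * (\<Prod>i<n. hc_inner (u ! i) (v ! i))))"
      (is "_ = (\<Sum>v\<in>?A n. ?x u v)") if "u \<in> ?A n" for u
    proof -
      have "(\<Sum>v\<in>A. ?k u v) = (\<Sum>v\<in>A. if length v = n then ?x u v else 0)"
      proof (intro sum.cong refl)
        fix v
        show "?k u v = (if length v = n then ?x u v else 0)" using that by (simp add: mult_ac)
      qed
      then show ?thesis by (simp only: sum.inter_filter[OF assms(1)])
    qed
    then show "(\<Sum>u\<in>?A n. \<Sum>v\<in>A. ?k u v) = complex_of_real (w n) *
      (\<Sum>u\<in>?A n. \<Sum>v\<in>?A n. cnj (c u) * c v * (\<Prod>i<n. hc_inner (u ! i) (v ! i)))"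
      by (simp add: sum_distrib_left)
  qed
  also have "Re \<dots> \<ge> 0"
    unfolding Re_sum
  proof (intro sum_nonneg)
    fix n
    have "0 \<le> Re (\<Sum>u\<in>?A n. \<Sum>v\<in>?A n. cnj (c u) * c v * (\<Prod>i<n. hc_inner (u ! i) (v ! i)))"
      by (rule hc_inner_prod_psd[where f = "\<lambda>u. u"]) (use assms(1) in auto)
    then show "0 \<le> Re (complex_of_real (w n) *
      (\<Sum>u\<in>?A n. \<Sum>v\<in>?A n. cnj (c u) * c v * (\<Prod>i<n. hc_inner (u ! i) (v ! i))))"
      using assms(2)[of n] by (simp only: Re_mult_of_real mult_nonneg_nonneg)
  qed
  finally show ?thesis .
qed

lemma fock_form_nonneg:
  assumes "0 \<le> t" shows "0 \<le> Re (fock_form t p p)"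
  unfolding fock_form_def word_inner_def
  by (rule word_weight_psd[where w = "\<lambda>n. t ^ (n choose 2)"]) (use assms in simp_all)

lemma fock_norm_nonneg [simp]: "0 \<le> t \<Longrightarrow> 0 \<le> fock_norm t p"
  by (simp add: fock_norm_def fock_form_nonneg)

lemma fock_norm_square: "0 \<le> t \<Longrightarrow> (fock_norm t p)\<^sup>2 = Re (fock_form t p p)"
  by (simp add: fock_norm_def fock_form_nonneg)

text \<open>The form is only semidefinite on formal combinations, so division by the norm of
  \<open>q\<close> is not always possible. Adding to \<open>p\<close> the multiple of
  \<open>q\<close> by a real \<open>s\<close> times the conjugate of \<open>z\<close> gives a real
  quadratic in \<open>s\<close> that is nonnegative, whether or not \<open>q\<close> is a null
  vector.\<close>

lemma fock_form_Cauchy_Schwarz: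
  assumes "0 \<le> t"
  shows "cmod (fock_form t p q) \<le> fock_norm t p * fock_norm t q"
proof -
  define a b z where "a = Re (fock_form t p p)" and "b = Re (fock_form t q q)" and "z = fock_form t p q"
  have Z: "cnj z * z = complex_of_real ((cmod z)\<^sup>2)"
    by (simp only: complex_norm_square mult.commute)
  have *: "0 \<le> a + 2 * s * (cmod z)\<^sup>2 + s\<^sup>2 * (cmod z)\<^sup>2 * b" for s
  proof -
    define c where "c = complex_of_real s * cnj z"
    let ?r = "p + Poly_Mapping.map ((*) c) q"
    have 1: "c * z = complex_of_real (s * (cmod z)\<^sup>2)"
      unfolding c_def mult.assoc Z by simp
    have 2: "cnj c * cnj z = complex_of_real (s * (cmod z)\<^sup>2)"
      unfolding complex_cnj_mult[symmetric] 1 by (rule complex_cnj_complex_of_real)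
    have "cnj c * c = complex_of_real s * complex_of_real s * (cnj z * z)"
      by (simp only: c_def complex_cnj_mult complex_cnj_complex_of_real complex_cnj_cnj mult_ac)
    then have 3: "cnj c * c = complex_of_real (s\<^sup>2 * (cmod z)\<^sup>2)"
      unfolding Z by (simp add: power2_eq_square)
    have "fock_form t ?r ?r = fock_form t p p + c * z + (cnj c * cnj z + (cnj c * c) * fock_form t q q)"
      unfolding fock_form_add_left fock_form_add_right fock_form_scale fock_form_commute[of t q p] z_def
      by (simp add: distrib_left mult.assoc)
    then have "fock_form t ?r ?r = fock_form t p p + complex_of_real (s * (cmod z)\<^sup>2)
        + (complex_of_real (s * (cmod z)\<^sup>2) + complex_of_real (s\<^sup>2 * (cmod z)\<^sup>2) * fock_form t q q)"
      unfolding 1 2 3 .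
    then have "Re (fock_form t ?r ?r) = a + s * (cmod z)\<^sup>2 + (s * (cmod z)\<^sup>2 + s\<^sup>2 * (cmod z)\<^sup>2 * b)"
      by (simp only: plus_complex.simps Re_complex_of_real Re_mult_of_real a_def b_def)
    then show ?thesis using fock_form_nonneg[OF assms, of ?r] by linarith
  qed
  have discriminant: "m \<le> a * b" if m: "0 \<le> m" "\<And>s. 0 \<le> a + 2 * s * m + s\<^sup>2 * m * b" and "0 \<le> b" for m
  proof (cases "b = 0")
    case True
    have "m = 0"
    proof (rule ccontr)
      assume "m \<noteq> 0"
      \<comment> \<open>For \<open>b = 0\<close> the quadratic is affine in \<open>s\<close>; this
        \<open>s\<close> would give it the value -1.\<close>
      then have "2 * (- (a + 1) / (2 * m)) * m = - (a + 1)" by simp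
      then show False using m(2)[of "- (a + 1) / (2 * m)"] True by simp
    qed
    then show ?thesis using True by simp
  next
    case False
    then have "b > 0" using \<open>0 \<le> b\<close> by simp
    \<comment> \<open>For positive \<open>b\<close> and \<open>m\<close>, \<open>s = - 1 / b\<close>
      is the minimizer of the quadratic.\<close>
    then have "2 * (- 1 / b) * m + (- 1 / b)\<^sup>2 * m * b = - (m / b)"
      by (simp add: field_simps power2_eq_square)
    then have "0 \<le> a - m / b" using m(2)[of "- 1 / b"] by linarith
    then show ?thesis using \<open>b > 0\<close> by (simp add: field_simps)
  qed
  have "(cmod z)\<^sup>2 \<le> a * b"
    by (rule discriminant) (simp, rule *, simp only: b_def fock_form_nonneg[OF assms])
  then have "(cmod z)\<^sup>2 \<le> (fock_norm t p * fock_norm t q)\<^sup>2"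
    by (simp add: power_mult_distrib fock_norm_square[OF assms] a_def b_def)
  then show ?thesis unfolding z_def by (rule power2_le_imp_le) (simp add: assms)
qed

lemma fock_norm_triangle:
  assumes "0 \<le> t"
  shows "fock_norm t (p + q) \<le> fock_norm t p + fock_norm t q"
proof (rule power2_le_imp_le)
  have "Re (fock_form t p q) \<le> fock_norm t p * fock_norm t q"
    using fock_form_Cauchy_Schwarz[OF assms, of p q] complex_Re_le_cmod order_trans by blast
  moreover have "Re (fock_form t q p) = Re (fock_form t p q)"
    by (simp add: fock_form_commute[of t q p])
  ultimately show "(fock_norm t (p + q))\<^sup>2 \<le> (fock_norm t p + fock_norm t q)\<^sup>2"
    by (simp add: fock_norm_square[OF assms] fock_form_add_left fock_form_add_right power2_sum)
qed (use assms in simp)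

lemma fock_norm_diff_commute: "fock_norm t (p - q) = fock_norm t (q - p)"
  by (simp add: fock_norm_def fock_form_diff_left fock_form_diff_right algebra_simps)

lemma fock_norm_triangle3:
  assumes "0 \<le> t"
  shows "fock_norm t (p - r) \<le> fock_norm t (p - q) + fock_norm t (q - r)"
  using fock_norm_triangle[OF assms, of "p - q" "q - r"] by simp

section \<open>Finite combinations as elements of the completion\<close>

definition fock_class :: "real \<Rightarrow> 'h::real_inner prefock \<Rightarrow> 'h fock" where
  "fock_class t p = fock_rel t `` {\<lambda>_. p}"

lemma fock_cauchyI:
  assumes "0 \<le> t" "(\<lambda>n. fock_norm t (p - X n)) \<longlonglongrightarrow> 0"
  shows "X \<in> fock_cauchy t"
  unfolding fock_cauchy_def
proof (intro CollectI allI impI)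
  fix e :: real assume "e > 0"
  then obtain K where K: "\<And>n. n \<ge> K \<Longrightarrow> fock_norm t (p - X n) < e / 2"
    using LIMSEQ_D[OF assms(2), of "e / 2"] assms(1) by auto
  have "fock_norm t (X m - X n) < e" if "m \<ge> K" "n \<ge> K" for m n
    using fock_norm_triangle3[OF assms(1), of "X m" "X n" p] fock_norm_diff_commute[of t "X m" p]
      K[OF that(1)] K[OF that(2)] by simp
  then show "\<exists>K. \<forall>m\<ge>K. \<forall>n\<ge>K. fock_norm t (X m - X n) < e" by blast
qed

lemma fock_norm_null_sum:
  assumes "0 \<le> t" "(a \<longlongrightarrow> 0) F" "(b \<longlongrightarrow> 0) F" "\<And>n. fock_norm t (Z n) \<le> a n + b n"
  shows "((\<lambda>n. fock_norm t (Z n)) \<longlongrightarrow> 0) F"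
proof (rule Lim_null_comparison)
  show "((\<lambda>n. a n + b n) \<longlongrightarrow> 0) F" using tendsto_add[OF assms(2,3)] by simp
  show "\<forall>\<^sub>F n in F. norm (fock_norm t (Z n)) \<le> a n + b n" using assms(1,4) by simp
qed

lemma fock_norm_zero [simp]: "fock_norm t 0 = 0"
  by (simp add: fock_norm_def)

text \<open>A sequence converging to an element \<open>p\<close> is automatically Cauchy, so the
  class of \<open>p\<close> consists of all sequences converging to \<open>p\<close>. The vectors
  obtained from the vacuum by \<open>s(h)\<close> are all of this kind, so no other classes have to
  be described.\<close>

lemma fock_rel_Image:
  assumes "0 \<le> t" "(\<lambda>n. fock_norm t (p - X n)) \<longlonglongrightarrow> 0"
  shows "fock_rel t `` {X} = {Y. (\<lambda>n. fock_norm t (p - Y n)) \<longlonglongrightarrow> 0}"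
proof -
  have "(\<lambda>n. fock_norm t (p - Y n)) \<longlonglongrightarrow> 0" if "(\<lambda>n. fock_norm t (X n - Y n)) \<longlonglongrightarrow> 0" for Y
    using fock_norm_triangle3[OF assms(1)] by (intro fock_norm_null_sum[OF assms that])
  moreover have "(\<lambda>n. fock_norm t (X n - Y n)) \<longlonglongrightarrow> 0" if Y: "(\<lambda>n. fock_norm t (p - Y n)) \<longlonglongrightarrow> 0" for Y
  proof (rule fock_norm_null_sum[OF assms Y])
    show "fock_norm t (X n - Y n) \<le> fock_norm t (p - X n) + fock_norm t (p - Y n)" for n
      using fock_norm_triangle3[OF assms(1), of "X n" "Y n" p] fock_norm_diff_commute[of t "X n" p] by simp
  qed
  ultimately show ?thesis
    using fock_cauchyI[OF assms] fock_cauchyI[OF assms(1)] by (auto simp: fock_rel_def)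
qed

lemma fock_class_eq: "0 \<le> t \<Longrightarrow> fock_class t p = {Y. (\<lambda>n. fock_norm t (p - Y n)) \<longlonglongrightarrow> 0}"
  unfolding fock_class_def by (rule fock_rel_Image) simp_all

lemma fock_rel_Image_class:
  assumes "0 \<le> t" "X \<in> fock_class t p"
  shows "fock_rel t `` {X} = fock_class t p"
  using assms fock_rel_Image[of t p X] by (simp add: fock_class_eq)

lemma const_in_fock_class: "0 \<le> t \<Longrightarrow> (\<lambda>_. p) \<in> fock_class t p"
  by (simp add: fock_class_eq)

text \<open>The union over representatives collapses to one class: boundedness sends every sequence
  converging to \<open>p\<close> to one converging to \<open>f p\<close>.\<close>

lemma fock_extend_class:
  assumes "0 \<le> t" and add: "\<And>p q. f (p + q) = f p + f q"
    and bound: "\<And>p. fock_norm t (f p) \<le> K * fock_norm t p"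
  shows "fock_extend t f (fock_class t p) = fock_class t (f p)"
proof -
  have diff: "f (p - q) = f p - f q" for p q using add[of "p - q" q] by simp
  have "(\<lambda>n. f (X n)) \<in> fock_class t (f p)" if "X \<in> fock_class t p" for X
  proof -
    have "(\<lambda>n. fock_norm t (p - X n)) \<longlonglongrightarrow> 0" using that assms(1) by (simp add: fock_class_eq)
    then have "(\<lambda>n. K * fock_norm t (p - X n)) \<longlonglongrightarrow> 0" using tendsto_mult_right_zero by blast
    then have "(\<lambda>n. fock_norm t (f p - f (X n))) \<longlonglongrightarrow> 0"
      by (rule tendsto_sandwich[of "\<lambda>_. 0", rotated 3]) (use assms(1) bound diff[symmetric] in auto)
    then show ?thesis using assms(1) by (simp add: fock_class_eq)
  qed
  then have "fock_rel t `` {\<lambda>n. f (X n)} = fock_class t (f p)" if "X \<in> fock_class t p" for X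
    using that fock_rel_Image_class[OF assms(1)] by blast
  then show ?thesis using const_in_fock_class[OF assms(1), of p] unfolding fock_extend_def by auto
qed

lemma fock_add_class:
  assumes "0 \<le> t"
  shows "fock_add t (fock_class t p) (fock_class t q) = fock_class t (p + q)"
proof -
  have "(\<lambda>n. X n + Y n) \<in> fock_class t (p + q)" if "X \<in> fock_class t p" "Y \<in> fock_class t q" for X Y
  proof -
    have "(\<lambda>n. fock_norm t (p - X n)) \<longlonglongrightarrow> 0" "(\<lambda>n. fock_norm t (q - Y n)) \<longlonglongrightarrow> 0"
      using that assms by (simp_all add: fock_class_eq)
    then have "(\<lambda>n. fock_norm t (p + q - (X n + Y n))) \<longlonglongrightarrow> 0"
    proof (rule fock_norm_null_sum[OF assms])
      show "fock_norm t (p + q - (X n + Y n)) \<le> fock_norm t (p - X n) + fock_norm t (q - Y n)" for n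
        using fock_norm_triangle[OF assms, of "p - X n" "q - Y n"] by (simp add: algebra_simps)
    qed
    then show ?thesis using assms by (simp add: fock_class_eq)
  qed
  then have "fock_rel t `` {\<lambda>n. X n + Y n} = fock_class t (p + q)"
    if "X \<in> fock_class t p" "Y \<in> fock_class t q" for X Y
    using that fock_rel_Image_class[OF assms] by blast
  then show ?thesis
    using const_in_fock_class[OF assms, of p] const_in_fock_class[OF assms, of q]
    unfolding fock_add_def by auto
qed

text \<open>Cauchy-Schwarz makes the form jointly continuous, so all choices of representatives have
  the same limit and \<open>the_elem\<close> is applied to a singleton.\<close>

lemma fock_inner_class:
  assumes "0 \<le> t"
  shows "fock_inner t (fock_class t p) (fock_class t q) = fock_form t p q"
proof -
  have "lim (\<lambda>n. fock_form t (X n) (Y n)) = fock_form t p q"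
    if "X \<in> fock_class t p" "Y \<in> fock_class t q" for X Y
  proof (rule limI)
    let ?a = "\<lambda>n. fock_norm t (p - X n)" and ?b = "\<lambda>n. fock_norm t (q - Y n)"
    have ab: "?a \<longlonglongrightarrow> 0" "?b \<longlonglongrightarrow> 0" using that assms by (simp_all add: fock_class_eq)
    have "(\<lambda>n. ?a n * (fock_norm t q + ?b n) + fock_norm t p * ?b n)
        \<longlonglongrightarrow> 0 * (fock_norm t q + 0) + fock_norm t p * 0"
      by (intro tendsto_intros ab)
    then have lim: "(\<lambda>n. ?a n * (fock_norm t q + ?b n) + fock_norm t p * ?b n) \<longlonglongrightarrow> 0" by simp
    have bd: "cmod (fock_form t (X n) (Y n) - fock_form t p q)
        \<le> ?a n * (fock_norm t q + ?b n) + fock_norm t p * ?b n" for n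
    proof -
      have "fock_form t (X n) (Y n) - fock_form t p q
          = - (fock_form t (p - X n) (Y n) + fock_form t p (q - Y n))"
        by (simp add: fock_form_diff_left fock_form_diff_right)
      then have "cmod (fock_form t (X n) (Y n) - fock_form t p q)
          \<le> cmod (fock_form t (p - X n) (Y n)) + cmod (fock_form t p (q - Y n))"
        by (metis norm_minus_cancel norm_triangle_ineq)
      also have "\<dots> \<le> ?a n * fock_norm t (Y n) + fock_norm t p * ?b n"
        by (intro add_mono fock_form_Cauchy_Schwarz assms)
      also have "fock_norm t (Y n) \<le> fock_norm t q + ?b n"
        using fock_norm_triangle3[OF assms, of "Y n" 0 q] fock_norm_diff_commute[of t "Y n" q] by simp
      finally show ?thesis using assms by (simp add: mult_left_mono)
    qed
    have "(\<lambda>n. fock_form t (X n) (Y n) - fock_form t p q) \<longlonglongrightarrow> 0"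
      by (rule Lim_null_comparison[OF _ lim]) (use bd in simp)
    then show "(\<lambda>n. fock_form t (X n) (Y n)) \<longlonglongrightarrow> fock_form t p q" by (simp add: LIM_zero_iff)
  qed
  then have "(\<Union>X\<in>fock_class t p. \<Union>Y\<in>fock_class t q. {lim (\<lambda>n. fock_form t (X n) (Y n))})
      = {fock_form t p q}"
    using const_in_fock_class[OF assms, of p] const_in_fock_class[OF assms, of q] by auto
  then show ?thesis unfolding fock_inner_def by simp
qed

section \<open>Creation and annihilation operators\<close>

lemma pre_creation_superset:
  assumes "finite A" "Poly_Mapping.keys p \<subseteq> A"
  shows "pre_creation h p =
    (\<Sum>u\<in>A. Poly_Mapping.single ((h, 0) # u) (Poly_Mapping.lookup p u))"
  unfolding pre_creation_def using assms by (intro sum.mono_neutral_left) (auto simp: in_keys_iff)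

lemma pre_creation_add: "pre_creation h (p + q) = pre_creation h p + pre_creation h q"
proof -
  have "pre_creation h r = (\<Sum>u\<in>Poly_Mapping.keys p \<union> Poly_Mapping.keys q.
      Poly_Mapping.single ((h, 0) # u) (Poly_Mapping.lookup r u))"
    if "r = p + q \<or> r = p \<or> r = q" for r
    using that Poly_Mapping.keys_add[of p q] by (intro pre_creation_superset) auto
  then show ?thesis by (simp add: lookup_add single_add sum.distrib)
qed

lemma pre_annihilation_superset:
  assumes "finite A" "Poly_Mapping.keys p \<subseteq> A"
  shows "pre_annihilation t h p = (\<Sum>u\<in>A - {[]}. Poly_Mapping.single (tl u)
      (complex_of_real (t ^ (length u - 1)) * hc_inner (h, 0) (hd u) * Poly_Mapping.lookup p u))"
  unfolding pre_annihilation_def using assms by (intro sum.mono_neutral_left) (auto simp: in_keys_iff)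

lemma pre_annihilation_add:
  "pre_annihilation t h (p + q) = pre_annihilation t h p + pre_annihilation t h q"
proof -
  have "pre_annihilation t h r = (\<Sum>u\<in>(Poly_Mapping.keys p \<union> Poly_Mapping.keys q) - {[]}.
      Poly_Mapping.single (tl u)
      (complex_of_real (t ^ (length u - 1)) * hc_inner (h, 0) (hd u) * Poly_Mapping.lookup r u))"
    if "r = p + q \<or> r = p \<or> r = q" for r
    using that Poly_Mapping.keys_add[of p q] by (intro pre_annihilation_superset) auto
  then show ?thesis by (simp add: lookup_add distrib_left single_add sum.distrib)
qed

lemma hc_inner_real: "hc_inner (h, 0) (h, 0) = complex_of_real ((norm h)\<^sup>2)"
  by (simp add: hc_inner_def complex_eq_iff power2_norm_eq_inner)

text \<open>Creation multiplies the form in degree \<open>n\<close> by \<open>t ^ n\<close> and the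
  squared norm of \<open>h\<close>. Since \<open>t \<le> 1\<close>, the weights
  \<open>t ^ (n choose 2) * (1 - t ^ n)\<close> are nonnegative, and positivity of the form with
  these weights is the required estimate.\<close>

lemma pre_creation_bound:
  assumes "0 \<le> t" "t \<le> 1"
  shows "fock_norm t (pre_creation h p) \<le> norm h * fock_norm t p"
proof (rule power2_le_imp_le)
  let ?A = "Poly_Mapping.keys p" and ?c = "Poly_Mapping.lookup p"
  have eq: "fock_form t (pre_creation h p) (pre_creation h p) = complex_of_real ((norm h)\<^sup>2) *
      (\<Sum>u\<in>?A. \<Sum>v\<in>?A. cnj (?c u) * ?c v * (complex_of_real (t ^ length u) * word_inner t u v))"
    unfolding pre_creation_def fock_form_sum_single word_inner_Cons hc_inner_real
    by (simp add: sum_distrib_left mult_ac)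
  have "0 \<le> Re (\<Sum>u\<in>?A. \<Sum>v\<in>?A. cnj (?c u) * ?c v *
    (if length u = length v
     then complex_of_real (t ^ (length u choose 2) * (1 - t ^ length u)) *
       (\<Prod>i<length u. hc_inner (u ! i) (v ! i)) else 0))"
    using assms power_le_one[OF assms]
    by (intro word_weight_psd[where w = "\<lambda>n. t ^ (n choose 2) * (1 - t ^ n)"]) auto
  also have "(\<Sum>u\<in>?A. \<Sum>v\<in>?A. cnj (?c u) * ?c v *
    (if length u = length v
     then complex_of_real (t ^ (length u choose 2) * (1 - t ^ length u)) *
       (\<Prod>i<length u. hc_inner (u ! i) (v ! i)) else 0))
    = (\<Sum>u\<in>?A. \<Sum>v\<in>?A. cnj (?c u) * ?c v * word_inner t u v -
        cnj (?c u) * ?c v * (complex_of_real (t ^ length u) * word_inner t u v))"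
    by (intro sum.cong refl) (simp add: word_inner_def algebra_simps)
  also have "\<dots> = fock_form t p p -
      (\<Sum>u\<in>?A. \<Sum>v\<in>?A. cnj (?c u) * ?c v * (complex_of_real (t ^ length u) * word_inner t u v))"
    by (simp only: sum_subtractf fock_form_def)
  finally have "Re (\<Sum>u\<in>?A. \<Sum>v\<in>?A. cnj (?c u) * ?c v * (complex_of_real (t ^ length u) * word_inner t u v))
      \<le> (fock_norm t p)\<^sup>2"
    using fock_norm_square[OF assms(1), of p] by simp
  then show "(fock_norm t (pre_creation h p))\<^sup>2 \<le> (norm h * fock_norm t p)\<^sup>2"
    unfolding power_mult_distrib fock_norm_square[OF assms(1), of "pre_creation h p"] eq Re_mult_of_real
    by (intro mult_left_mono zero_le_power2)
qed (use assms in simp)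

lemma pre_annihilation_adjoint:
  "fock_form t (pre_annihilation t h p) q = fock_form t p (pre_creation h q)"
proof -
  let ?A = "Poly_Mapping.keys p" and ?c = "Poly_Mapping.lookup p"
  let ?B = "Poly_Mapping.keys q" and ?d = "Poly_Mapping.lookup q"
  have q: "q = (\<Sum>v\<in>?B. Poly_Mapping.single v (?d v))" by (simp add: sum_single_lookup)
  have p: "p = (\<Sum>u\<in>?A. Poly_Mapping.single u (?c u))" by (simp add: sum_single_lookup)
  have "fock_form t (pre_annihilation t h p) q = (\<Sum>u\<in>?A - {[]}. \<Sum>v\<in>?B.
      cnj (complex_of_real (t ^ (length u - 1)) * hc_inner (h, 0) (hd u) * ?c u) * ?d v * word_inner t (tl u) v)"
    by (subst q) (simp only: pre_annihilation_def fock_form_sum_single)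
  also have "\<dots> = (\<Sum>u\<in>?A - {[]}. \<Sum>v\<in>?B. cnj (?c u) * ?d v * word_inner t u ((h, 0) # v))"
  proof (intro sum.cong refl)
    fix u v assume "u \<in> ?A - {[]}"
    then obtain x u' where u: "u = x # u'" by (cases u) auto
    show "cnj (complex_of_real (t ^ (length u - 1)) * hc_inner (h, 0) (hd u) * ?c u) * ?d v * word_inner t (tl u) v
        = cnj (?c u) * ?d v * word_inner t u ((h, 0) # v)"
      unfolding u word_inner_Cons by (simp add: hc_inner_commute[of x])
  qed
  \<comment> \<open>The empty word may be included again: it is orthogonal to every word beginning
    with \<open>(h, 0)\<close>.\<close>
  also have "\<dots> = (\<Sum>u\<in>?A. \<Sum>v\<in>?B. cnj (?c u) * ?d v * word_inner t u ((h, 0) # v))"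
    by (intro sum.mono_neutral_left) (auto simp: word_inner_def)
  also have "\<dots> = fock_form t p (pre_creation h q)"
    by (subst (3) p) (simp only: pre_creation_def fock_form_sum_single)
  finally show ?thesis .
qed

text \<open>With \<open>q\<close> the annihilated vector, its squared norm is the form of
  \<open>p\<close> and the creation of \<open>q\<close>; Cauchy-Schwarz and the bound for creation
  leave one factor of the norm of \<open>q\<close> to cancel.\<close>

lemma pre_annihilation_bound:
  assumes "0 \<le> t" "t \<le> 1"
  shows "fock_norm t (pre_annihilation t h p) \<le> norm h * fock_norm t p"
proof -
  let ?q = "pre_annihilation t h p"
  have "(fock_norm t ?q)\<^sup>2 = Re (fock_form t p (pre_creation h ?q))"
    by (simp add: fock_norm_square[OF assms(1)] pre_annihilation_adjoint)
  also have "\<dots> \<le> fock_norm t p * fock_norm t (pre_creation h ?q)"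
    using fock_form_Cauchy_Schwarz[OF assms(1)] complex_Re_le_cmod order_trans by blast
  also have "\<dots> \<le> fock_norm t p * (norm h * fock_norm t ?q)"
    using assms by (intro mult_left_mono pre_creation_bound) auto
  finally have "fock_norm t ?q * fock_norm t ?q \<le> (norm h * fock_norm t p) * fock_norm t ?q"
    by (simp add: power2_eq_square mult_ac)
  then show ?thesis
    using assms fock_norm_nonneg[OF assms(1), of ?q] fock_norm_nonneg[OF assms(1), of p]
    by (cases "fock_norm t ?q = 0") (auto simp: mult_le_cancel_right)
qed

section \<open>Vacuum moments of \<open>s(h)\<close>\<close>

definition pre_semicircular :: "real \<Rightarrow> 'h::real_inner \<Rightarrow> 'h prefock \<Rightarrow> 'h prefock" where
  "pre_semicircular t h p = pre_annihilation t h p + pre_creation h p"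

lemma semicircular_class:
  assumes "0 \<le> t" "t \<le> 1"
  shows "semicircular t h (fock_class t p) = fock_class t (pre_semicircular t h p)"
  unfolding semicircular_def annihilation_def creation_def pre_semicircular_def
  by (simp add: fock_add_class[OF assms(1)]
      fock_extend_class[OF assms(1) pre_annihilation_add pre_annihilation_bound[OF assms]]
      fock_extend_class[OF assms(1) pre_creation_add pre_creation_bound[OF assms]])

lemma vacuum_state_semicircular:
  assumes "0 \<le> t" "t \<le> 1"
  shows "vacuum_state t (semicircular t h ^^ n) = fock_form t (Poly_Mapping.single [] 1)
    ((pre_semicircular t h ^^ n) (Poly_Mapping.single [] 1))"
proof -
  have "(semicircular t h ^^ n) (fock_class t p) = fock_class t ((pre_semicircular t h ^^ n) p)" for p
    by (induction n) (simp_all add: semicircular_class[OF assms])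
  then show ?thesis
    unfolding vacuum_state_def fock_vacuum_def fock_class_def[symmetric]
    by (simp add: fock_inner_class[OF assms(1)])
qed

lemma pre_semicircular_add:
  "(pre_semicircular t h ^^ n) (p + q) = (pre_semicircular t h ^^ n) p + (pre_semicircular t h ^^ n) q"
  by (induction n)
     (simp_all add: pre_semicircular_def pre_annihilation_add pre_creation_add add_ac)

lemma pre_creation_single:
  "pre_creation h (Poly_Mapping.single u c) = Poly_Mapping.single ((h, 0) # u) c"
  by (simp add: pre_creation_superset[of "{u}"] lookup_single)

lemma pre_annihilation_single:
  "pre_annihilation t h (Poly_Mapping.single [] c) = 0"
  "pre_annihilation t h (Poly_Mapping.single (x # u) c)
    = Poly_Mapping.single u (complex_of_real (t ^ length u) * hc_inner (h, 0) x * c)"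
  by (simp_all add: pre_annihilation_superset[of "{[]}"] pre_annihilation_superset[of "{x # u}"]
      lookup_single)

text \<open>Starting from the vacuum only tensor powers of \<open>h\<close> occur. Creation raises
  the power \<open>k\<close>; annihilation lowers it with the scalar
  \<open>t ^ (k - 1) * \<rho>\<close>, the weight of a down step. The induction removes the operator
  applied first, hence the general \<open>k\<close> and \<open>c\<close>.\<close>

lemma fock_form_pre_semicircular:
  assumes "t = \<rho>\<^sup>2" "(norm h)\<^sup>2 = \<rho>"
  shows "fock_form t (Poly_Mapping.single [] 1)
      ((pre_semicircular t h ^^ n) (Poly_Mapping.single (replicate k (h, 0)) c))
    = c * complex_of_real (dyck_sum \<rho> n k)"
proof (induction n arbitrary: k c)
  case 0
  then show ?case by (cases k) (simp_all add: fock_form_single word_inner_def numeral_2_eq_2)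
next
  case (Suc n)
  have cre: "pre_creation h (Poly_Mapping.single (replicate k (h, 0)) c)
      = Poly_Mapping.single (replicate (Suc k) (h, 0)) c"
    by (simp add: pre_creation_single)
  show ?case
  proof (cases k)
    case 0
    have "pre_semicircular t h (Poly_Mapping.single (replicate k (h, 0)) c)
        = Poly_Mapping.single (replicate (Suc k) (h, 0)) c"
      unfolding pre_semicircular_def cre using 0 by (simp add: pre_annihilation_single)
    then show ?thesis using Suc.IH[of "Suc k" c] 0 by (simp add: funpow_Suc_right del: funpow.simps)
  next
    case (Suc j)
    have "pre_annihilation t h (Poly_Mapping.single (replicate k (h, 0)) c)
        = Poly_Mapping.single (replicate j (h, 0)) (complex_of_real (t ^ j * \<rho>) * c)"
      unfolding Suc using assms(2) by (simp add: pre_annihilation_single hc_inner_real)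
    then have "pre_semicircular t h (Poly_Mapping.single (replicate k (h, 0)) c)
        = Poly_Mapping.single (replicate j (h, 0)) (complex_of_real (t ^ j * \<rho>) * c)
          + Poly_Mapping.single (replicate (Suc k) (h, 0)) c"
      unfolding pre_semicircular_def cre by simp
    then show ?thesis
      unfolding funpow_Suc_right comp_apply
      by (simp only: pre_semicircular_add fock_form_add_right Suc.IH)
         (simp add: Suc assms(1) algebra_simps)
  qed
qed

lemma vacuum_state_eq:
  fixes h :: "'h :: real_inner"
  assumes "0 < \<rho>" "\<rho> \<le> 1" "norm h = sqrt \<rho>"
  shows "vacuum_state (\<rho>\<^sup>2) (semicircular (\<rho>\<^sup>2) h ^^ n)
    = complex_of_real (\<Sum>V\<in>NC2 n. arc_weight \<rho> V)"
proof -
  have "vacuum_state (\<rho>\<^sup>2) (semicircular (\<rho>\<^sup>2) h ^^ n) = complex_of_real (dyck_sum \<rho> n 0)"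
    using vacuum_state_semicircular[of "\<rho>\<^sup>2" n h] assms
      fock_form_pre_semicircular[OF refl, of h \<rho> n 0 1]
    by (simp add: power_le_one)
  then show ?thesis using sum_arc_weight_dyck_sum[of \<rho> n] assms(1) by simp
qed

section \<open>Moments of Wigner processes\<close>

fun walk_weight :: "(nat \<Rightarrow> complex mat) \<Rightarrow> nat \<Rightarrow> (nat \<times> nat) list \<Rightarrow> complex" where
  "walk_weight A x [] = 1"
| "walk_weight A x ((t, y) # ws) = A t $$ (x, y) * walk_weight A y ws"

definition open_walks :: "nat \<Rightarrow> nat \<Rightarrow> nat \<Rightarrow> nat list \<Rightarrow> (nat \<times> nat) list set" where
  "open_walks N i j ts = {ws. map fst ws = ts \<and> snd ` set ws \<subseteq> {..<N} \<and> endpoint i ws = j}"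

lemma finite_open_walks: "finite (open_walks N i j ts)"
proof (rule finite_subset)
  show "open_walks N i j ts \<subseteq> {ws. set ws \<subseteq> set ts \<times> {..<N} \<and> length ws = length ts}"
    by (force simp: open_walks_def)
qed (rule finite_lists_length_eq, simp)

lemma closed_walks_eq: "closed_walks N ts = (SIGMA x:{..<N}. open_walks N x x ts)"
  by (auto simp: closed_walks_def open_walks_def verts_def)

lemma foldr_mat_mult_carrier:
  assumes "\<And>t. t \<in> set ts \<Longrightarrow> A t \<in> carrier_mat N N"
  shows "foldr (*) (map (\<lambda>t. c \<cdot>\<^sub>m A t) ts) (1\<^sub>m N) \<in> carrier_mat N N"
  using assms by (induction ts) (auto intro!: mult_carrier_mat)

lemma smult_mult_mat_index:
  fixes A B :: "'c :: comm_semiring_0 mat"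
  assumes "A \<in> carrier_mat N N" "B \<in> carrier_mat N N" "i < N" "j < N"
  shows "(c \<cdot>\<^sub>m A * B) $$ (i, j) = (\<Sum>k<N. c * A $$ (i, k) * B $$ (k, j))"
  using assms by (simp add: scalar_prod_def atLeast0LessThan)

lemma foldr_mat_mult_index:
  fixes A :: "nat \<Rightarrow> complex mat"
  assumes "\<And>t. t \<in> set ts \<Longrightarrow> A t \<in> carrier_mat N N" "i < N" "j < N"
  shows "foldr (*) (map (\<lambda>t. c \<cdot>\<^sub>m A t) ts) (1\<^sub>m N) $$ (i, j)
    = c ^ length ts * (\<Sum>ws\<in>open_walks N i j ts. walk_weight A i ws)"
  using assms
proof (induction ts arbitrary: i)
  case Nil
  have "open_walks N i j [] = (if i = j then {[]} else {})" by (auto simp: open_walks_def)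
  then show ?case using Nil by simp
next
  case (Cons t ts)
  let ?P = "foldr (*) (map (\<lambda>t. c \<cdot>\<^sub>m A t) ts) (1\<^sub>m N)"
  have P: "?P \<in> carrier_mat N N" using Cons.prems by (intro foldr_mat_mult_carrier) auto
  have At: "A t \<in> carrier_mat N N" using Cons.prems by simp
  have "(c \<cdot>\<^sub>m A t * ?P) $$ (i, j) = (\<Sum>k<N. c * A t $$ (i, k) * ?P $$ (k, j))"
    using smult_mult_mat_index[OF At P] Cons.prems by simp
  also have "\<dots> = (\<Sum>k<N. c * A t $$ (i, k) *
      (c ^ length ts * (\<Sum>ws\<in>open_walks N k j ts. walk_weight A k ws)))"
    using Cons.IH Cons.prems by (intro sum.cong refl) simp
  also have "\<dots> = c ^ length (t # ts) *
      (\<Sum>k<N. \<Sum>ws\<in>open_walks N k j ts. A t $$ (i, k) * walk_weight A k ws)"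
    by (simp add: sum_distrib_left mult_ac)
  also have "(\<Sum>k<N. \<Sum>ws\<in>open_walks N k j ts. A t $$ (i, k) * walk_weight A k ws)
      = (\<Sum>(k, ws)\<in>(SIGMA k:{..<N}. open_walks N k j ts). A t $$ (i, k) * walk_weight A k ws)"
    by (rule sum.Sigma) (simp_all add: finite_open_walks)
  also have "\<dots> = (\<Sum>ws\<in>open_walks N i j (t # ts). walk_weight A i ws)"
    by (rule sum.reindex_bij_witness[of _ "\<lambda>ws. (snd (hd ws), tl ws)" "\<lambda>(k, ws). (t, k) # ws"])
       (auto simp: open_walks_def image_subset_iff)
  finally show ?case by simp
qed

lemma mat_trace_scaled_product:
  assumes "\<And>k. k \<ge> 1 \<Longrightarrow> W N k \<omega> \<in> carrier_mat N N"
  shows "mat_trace (scaled_product W N m \<omega>) = complex_of_real (1 / sqrt (real N)) ^ m *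
    (\<Sum>(x, ws)\<in>closed_walks N [1..<Suc m]. walk_weight (\<lambda>k. W N k \<omega>) x ws)"
proof -
  have c: "scaled_product W N m \<omega> \<in> carrier_mat N N"
    unfolding scaled_product_def using assms by (intro foldr_mat_mult_carrier) auto
  have "mat_trace (scaled_product W N m \<omega>) = (\<Sum>x<N. scaled_product W N m \<omega> $$ (x, x))"
    using c by (simp add: mat_trace_def)
  also have "\<dots> = (\<Sum>x<N. complex_of_real (1 / sqrt (real N)) ^ m *
      (\<Sum>ws\<in>open_walks N x x [1..<Suc m]. walk_weight (\<lambda>k. W N k \<omega>) x ws))"
  proof (rule sum.cong[OF refl])
    fix x assume "x \<in> {..<N}"
    then show "scaled_product W N m \<omega> $$ (x, x) = complex_of_real (1 / sqrt (real N)) ^ m *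
      (\<Sum>ws\<in>open_walks N x x [1..<Suc m]. walk_weight (\<lambda>k. W N k \<omega>) x ws)"
      unfolding scaled_product_def
      using foldr_mat_mult_index[of "[1..<Suc m]" "\<lambda>k. W N k \<omega>" N x x "complex_of_real (1 / sqrt (real N))"]
        assms by (simp del: upt_Suc)
  qed
  also have "\<dots> = complex_of_real (1 / sqrt (real N)) ^ m *
    (\<Sum>(x, ws)\<in>closed_walks N [1..<Suc m]. walk_weight (\<lambda>k. W N k \<omega>) x ws)"
    unfolding closed_walks_eq sum_distrib_left[symmetric]
    by (subst sum.Sigma) (simp_all add: finite_open_walks)
  finally show ?thesis .
qed

text \<open>Symmetry of the entries allows the directed index of a step to be replaced by its
  undirected edge. Since the times are distinct, no two steps coincide as pairs of time and edge,
  and the product over the list becomes one over a set.\<close>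

lemma walk_weight_symmetric:
  assumes "distinct (map fst ws)" "verts x ws \<subseteq> {..<N}"
    and "\<And>t a b. t \<in> fst ` set ws \<Longrightarrow> a < N \<Longrightarrow> b < N \<Longrightarrow> A t $$ (a, b) = A t $$ uedge a b"
  shows "walk_weight A x ws = (\<Prod>(t, e)\<in>tedges x ws. A t $$ e)"
  using assms
proof (induction A x ws rule: walk_weight.induct)
  case (2 A x t y ws)
  have "(t, uedge x y) \<notin> tedges y ws" using tedges_fst[of t "uedge x y" y ws] "2.prems"(1) by auto
  moreover have "walk_weight A y ws = (\<Prod>(t, e)\<in>tedges y ws. A t $$ e)"
    using "2.prems" by (intro "2.IH") (auto simp: verts_def)
  moreover have "A t $$ (x, y) = A t $$ uedge x y"
    using "2.prems"(2) by (intro "2.prems"(3)) (auto simp: verts_def)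
  ultimately show ?case by simp
qed simp

lemma prod_tedges:
  fixes g :: "nat \<Rightarrow> nat \<times> nat \<Rightarrow> 'c :: comm_monoid_mult"
  shows "(\<Prod>(t, e)\<in>tedges x ws. g t e) = (\<Prod>e\<in>edges x ws. \<Prod>t\<in>etimes x ws e. g t e)"
proof -
  have "(\<Prod>e\<in>edges x ws. \<Prod>t\<in>etimes x ws e. g t e)
      = (\<Prod>(e, t)\<in>(SIGMA e:edges x ws. etimes x ws e). g t e)"
    by (rule prod.Sigma) simp_all
  also have "\<dots> = (\<Prod>(t, e)\<in>tedges x ws. g t e)"
  proof (rule prod.reindex_bij_witness[of _ "\<lambda>(t, e). (e, t)" "\<lambda>(e, t). (t, e)"])
    fix p assume "p \<in> tedges x ws"
    then show "(case p of (t, e) \<Rightarrow> (e, t)) \<in> (SIGMA e:edges x ws. etimes x ws e)"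
      by (cases p) (auto simp: etimes_def edges_iff)
  qed (auto simp: etimes_def)
  finally show ?thesis by simp
qed

text \<open>A crude substitute for the generalized Hoelder inequality: the product is at most a
  power of the largest factor, which is one of the summands. It reduces mixed moments to moments of
  single entries.\<close>

lemma prod_le_sum_power:
  fixes a :: "'i \<Rightarrow> real"
  assumes "finite S" "S \<noteq> {}" "\<And>i. i \<in> S \<Longrightarrow> 0 \<le> a i"
  shows "(\<Prod>i\<in>S. a i) \<le> (\<Sum>i\<in>S. a i ^ card S)"
proof -
  have "Max (a ` S) \<in> a ` S" using assms by simp
  then obtain j where j: "j \<in> S" "a j = Max (a ` S)" by auto
  have "(\<Prod>i\<in>S. a i) \<le> (\<Prod>i\<in>S. a j)"
    using assms j by (intro prod_mono) auto
  also have "\<dots> = a j ^ card S" by simp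
  also have "\<dots> \<le> (\<Sum>i\<in>S. a i ^ card S)"
    using assms j by (intro member_le_sum) auto
  finally show ?thesis .
qed

lemma mat_adjoint_index:
  fixes A :: "complex mat"
  assumes "A \<in> carrier_mat N N" "i < N" "j < N"
  shows "mat_adjoint A $$ (i, j) = cnj (A $$ (j, i))"
  using assms by (simp add: mat_adjoint_def mat_of_rows_def)

lemma tedges_indices:
  assumes "(t, e) \<in> tedges x ws" "verts x ws \<subseteq> {..<N}"
  obtains i j where "e = (i, j)" "i \<le> j" "j < N"
proof -
  obtain a b where "e = uedge a b" "a < N" "b < N"
    using assms by (elim tedges_vertsE) auto
  then show thesis using that[of "min a b" "max a b"] by (simp add: uedge_def)
qed

section \<open>Expectations of walk weights\<close>

context wigner_process
begin

text \<open>At equal times the covariance gives expectation 1 for the square of the entry, which is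
  also that of its squared modulus. Their difference has real part twice the squared imaginary part,
  so this has expectation zero.\<close>

lemma AE_real:
  assumes "k \<ge> 1" "i < N" "j < N"
  shows "AE \<omega> in M N. Im (W N k \<omega> $$ (i, j)) = 0"
proof -
  let ?w = "\<lambda>\<omega>. W N k \<omega> $$ (i, j)"
  have w: "?w \<in> borel_measurable (M N)" by (rule measurable[OF assms])
  have i2: "integrable (M N) (\<lambda>\<omega>. (cmod (?w \<omega>))\<^sup>2)" using moments_finite[OF assms, of 2] .
  have iw: "integrable (M N) (\<lambda>\<omega>. ?w \<omega> * ?w \<omega>)"
    by (rule Bochner_Integration.integrable_bound[OF i2])
       (use w in \<open>auto simp: norm_mult power2_eq_square\<close>)
  have re: "(\<integral>\<omega>. Re (?w \<omega> * ?w \<omega>) \<partial>M N) = 1"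
    unfolding integral_Re[OF iw] using covariance[of k k i N j] assms by simp
  have eq: "2 * (Im (?w \<omega>))\<^sup>2 = (cmod (?w \<omega>))\<^sup>2 - Re (?w \<omega> * ?w \<omega>)" for \<omega>
    unfolding cmod_power2 by (simp add: power2_eq_square)
  have ii: "integrable (M N) (\<lambda>\<omega>. 2 * (Im (?w \<omega>))\<^sup>2)"
    unfolding eq by (intro Bochner_Integration.integrable_diff i2 integrable_Re iw)
  have "(\<integral>\<omega>. 2 * (Im (?w \<omega>))\<^sup>2 \<partial>M N) = 0"
    unfolding eq Bochner_Integration.integral_diff[OF i2 integrable_Re[OF iw]] variance_one[OF assms] re
    by simp
  then have "AE \<omega> in M N. 2 * (Im (?w \<omega>))\<^sup>2 = 0"
    by (subst integral_nonneg_eq_0_iff_AE[OF ii, symmetric]) simp_all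
  then show ?thesis by simp
qed

text \<open>Self-adjointness equates an entry with the conjugate of its mirror image, and almost
  sure realness removes the conjugate.\<close>

lemma AE_symmetric:
  assumes "k \<ge> 1" "i < N" "j < N"
  shows "AE \<omega> in M N. W N k \<omega> $$ (i, j) = W N k \<omega> $$ uedge i j"
proof (cases "i \<le> j")
  case True
  then show ?thesis by (simp add: uedge_def)
next
  case False
  have "N \<ge> 1" using assms by simp
  have "W N k \<omega> $$ (i, j) = cnj (W N k \<omega> $$ (j, i))" if "\<omega> \<in> space (M N)" for \<omega>
    using mat_adjoint_index[OF carrier[OF \<open>N \<ge> 1\<close> assms(1) that] assms(2,3)]
      self_adjoint[OF \<open>N \<ge> 1\<close> assms(1) that] by simp
  then have "AE \<omega> in M N. W N k \<omega> $$ (i, j) = cnj (W N k \<omega> $$ (j, i))" by simp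
  moreover have "AE \<omega> in M N. Im (W N k \<omega> $$ (j, i)) = 0" by (rule AE_real[OF assms(1,3,2)])
  ultimately show ?thesis
  proof eventually_elim
    case (elim \<omega>)
    then show ?case using False by (auto simp: uedge_def complex_eq_iff)
  qed
qed

lemma walk_weight_measurable:
  assumes "\<forall>t\<in>fst ` set ws. t \<ge> 1" "verts x ws \<subseteq> {..<N}"
  shows "(\<lambda>\<omega>. walk_weight (\<lambda>k. W N k \<omega>) x ws) \<in> borel_measurable (M N)"
  using assms
proof (induction ws arbitrary: x)
  case (Cons p ws)
  obtain t y where p: "p = (t, y)" by fastforce
  have "(\<lambda>\<omega>. W N t \<omega> $$ (x, y)) \<in> borel_measurable (M N)"
    using Cons.prems p by (intro measurable) (auto simp: verts_def)
  moreover have "(\<lambda>\<omega>. walk_weight (\<lambda>k. W N k \<omega>) y ws) \<in> borel_measurable (M N)"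
    using Cons.prems p by (intro Cons.IH) (auto simp: verts_def)
  ultimately show ?case using p by simp
qed simp

lemma AE_walk_weight:
  assumes "distinct (map fst ws)" "\<forall>t\<in>fst ` set ws. t \<ge> 1" "verts x ws \<subseteq> {..<N}"
  shows "AE \<omega> in M N. walk_weight (\<lambda>k. W N k \<omega>) x ws = (\<Prod>(t, e)\<in>tedges x ws. W N t \<omega> $$ e)"
proof -
  have "AE \<omega> in M N. \<forall>t\<in>fst ` set ws. \<forall>a\<in>{..<N}. \<forall>b\<in>{..<N}. W N t \<omega> $$ (a, b) = W N t \<omega> $$ uedge a b"
    using assms(2) by (intro AE_finite_allI AE_symmetric) auto
  then show ?thesis
  proof eventually_elim
    case (elim \<omega>)
    then show ?case by (intro walk_weight_symmetric[OF assms(1,3)]) auto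
  qed
qed

text \<open>Entries of one process at different times are dependent, so the product is dominated by
  a sum of single moments of order \<open>card S\<close>. For empty \<open>S\<close> the product is
  the constant 1: integrable on a probability space, hence \<open>N \<ge> 1\<close>, but not bounded
  by the empty sum.\<close>

lemma prod_entries_integrable:
  assumes "finite S" "\<And>t e. (t, e) \<in> S \<Longrightarrow> t \<ge> 1 \<and> fst e < N \<and> snd e < N"
  shows "N \<ge> 1 \<Longrightarrow> integrable (M N) (\<lambda>\<omega>. \<Prod>(t, e)\<in>S. W N t \<omega> $$ e)"
    and "S \<noteq> {} \<Longrightarrow> cmod (\<integral>\<omega>. (\<Prod>(t, e)\<in>S. W N t \<omega> $$ e) \<partial>M N)
      \<le> (\<Sum>(t, e)\<in>S. \<integral>\<omega>. cmod (W N t \<omega> $$ e) ^ card S \<partial>M N)"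
proof -
  define X where "X = (\<lambda>p \<omega>. W N (fst p) \<omega> $$ snd p)"
  have meas: "X p \<in> borel_measurable (M N)" if "p \<in> S" for p
    using assms(2)[of "fst p" "snd p"] that measurable[of "fst p" "fst (snd p)" N "snd (snd p)"]
    unfolding X_def by simp
  have m: "(\<lambda>\<omega>. \<Prod>p\<in>S. X p \<omega>) \<in> borel_measurable (M N)"
    by (intro borel_measurable_prod meas)
  have mom: "integrable (M N) (\<lambda>\<omega>. cmod (X p \<omega>) ^ n)" if "p \<in> S" for p n
    using assms(2)[of "fst p" "snd p"] that moments_finite[of "fst p" "fst (snd p)" N "snd (snd p)" n]
    unfolding X_def by simp
  have int: "integrable (M N) (\<lambda>\<omega>. \<Sum>p\<in>S. cmod (X p \<omega>) ^ card S)"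
    by (intro Bochner_Integration.integrable_sum mom)
  have le: "cmod (\<Prod>p\<in>S. X p \<omega>) \<le> (\<Sum>p\<in>S. cmod (X p \<omega>) ^ card S)" if "S \<noteq> {}" for \<omega>
    unfolding prod_norm[symmetric] by (rule prod_le_sum_power[OF assms(1) that norm_ge_zero])
  have i: "integrable (M N) (\<lambda>\<omega>. \<Prod>p\<in>S. X p \<omega>)" if ne: "S \<noteq> {}"
  proof (rule Bochner_Integration.integrable_bound[OF int m], rule AE_I2)
    fix \<omega>
    show "norm (\<Prod>p\<in>S. X p \<omega>) \<le> norm (\<Sum>p\<in>S. cmod (X p \<omega>) ^ card S)"
      unfolding real_norm_def by (rule order_trans[OF le[OF ne] abs_ge_self])
  qed
  show "integrable (M N) (\<lambda>\<omega>. \<Prod>(t, e)\<in>S. W N t \<omega> $$ e)" if "N \<ge> 1"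
  proof -
    interpret P: prob_space "M N" using prob_space[OF that] .
    show ?thesis using i unfolding X_def case_prod_unfold by (cases "S = {}") simp_all
  qed
  show "cmod (\<integral>\<omega>. (\<Prod>(t, e)\<in>S. W N t \<omega> $$ e) \<partial>M N)
      \<le> (\<Sum>(t, e)\<in>S. \<integral>\<omega>. cmod (W N t \<omega> $$ e) ^ card S \<partial>M N)" if ne: "S \<noteq> {}"
  proof -
    have "cmod (\<integral>\<omega>. (\<Prod>p\<in>S. X p \<omega>) \<partial>M N) \<le> (\<integral>\<omega>. cmod (\<Prod>p\<in>S. X p \<omega>) \<partial>M N)"
      by (rule integral_norm_bound)
    also have "\<dots> \<le> (\<integral>\<omega>. (\<Sum>p\<in>S. cmod (X p \<omega>) ^ card S) \<partial>M N)"
      by (intro integral_mono int integrable_norm i ne le)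
    also have "\<dots> = (\<Sum>p\<in>S. \<integral>\<omega>. cmod (X p \<omega>) ^ card S \<partial>M N)"
      by (intro Bochner_Integration.integral_sum mom)
    finally show ?thesis unfolding X_def case_prod_unfold .
  qed
qed

lemma expectation_walk_weight:
  assumes "distinct (map fst ws)" "\<forall>t\<in>fst ` set ws. t \<ge> 1" "verts x ws \<subseteq> {..<N}"
  shows "integrable (M N) (\<lambda>\<omega>. walk_weight (\<lambda>k. W N k \<omega>) x ws)"
    and "(\<integral>\<omega>. walk_weight (\<lambda>k. W N k \<omega>) x ws \<partial>M N)
      = (\<Prod>e\<in>edges x ws. \<integral>\<omega>. (\<Prod>t\<in>etimes x ws e. W N t \<omega> $$ e) \<partial>M N)"
proof -
  have "N \<ge> 1" using assms(3) by (cases N) (auto simp: verts_def)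
  interpret P: prob_space "M N" using prob_space[OF \<open>N \<ge> 1\<close>] .
  have idx: "t \<ge> 1 \<and> fst e < N \<and> snd e < N" if "(t, e) \<in> tedges x ws" for t e
    using tedges_fst[OF that] assms(2) by (rule_tac tedges_indices[OF that assms(3)]) auto
  have m: "(\<lambda>\<omega>. walk_weight (\<lambda>k. W N k \<omega>) x ws) \<in> borel_measurable (M N)"
    by (rule walk_weight_measurable[OF assms(2,3)])
  have i: "integrable (M N) (\<lambda>\<omega>. \<Prod>(t, e)\<in>tedges x ws. W N t \<omega> $$ e)"
    by (rule prod_entries_integrable) (use idx \<open>N \<ge> 1\<close> in auto)
  note ae = AE_walk_weight[OF assms]
  show "integrable (M N) (\<lambda>\<omega>. walk_weight (\<lambda>k. W N k \<omega>) x ws)"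
    using integrable_cong_AE[THEN iffD2, OF m borel_measurable_integrable[OF i] ae i] .
  have "(\<integral>\<omega>. walk_weight (\<lambda>k. W N k \<omega>) x ws \<partial>M N)
      = (\<integral>\<omega>. (\<Prod>(t, e)\<in>tedges x ws. W N t \<omega> $$ e) \<partial>M N)"
    by (rule integral_cong_AE[OF m borel_measurable_integrable[OF i] ae])
  also have "\<dots> = (\<integral>\<omega>. (\<Prod>e\<in>edges x ws. \<Prod>t\<in>etimes x ws e. W N t \<omega> $$ e) \<partial>M N)"
    by (simp only: prod_tedges)
  also have "\<dots> = (\<Prod>e\<in>edges x ws. \<integral>\<omega>. (\<Prod>t\<in>etimes x ws e. W N t \<omega> $$ e) \<partial>M N)"
  proof (rule P.indep_vars_lebesgue_integral[OF finite_edges])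
    let ?Y = "\<lambda>(i, j) \<omega>. \<lambda>k\<in>{1..}. W N k \<omega> $$ (i, j)"
    have tm: "t \<ge> 1" if "t \<in> etimes x ws e" for t e
      using that idx by (auto simp: etimes_def)
    have "edges x ws \<subseteq> {(i, j). i \<le> j \<and> j < N}"
    proof
      fix e assume "e \<in> edges x ws"
      then obtain t where "(t, e) \<in> tedges x ws" unfolding edges_iff by blast
      then show "e \<in> {(i, j). i \<le> j \<and> j < N}" using assms(3) by (elim tedges_indices) auto
    qed
    then have iv: "P.indep_vars (\<lambda>_. PiM {1..} (\<lambda>_. borel)) ?Y (edges x ws)"
      using P.indep_vars_subset[OF indep_processes[OF \<open>N \<ge> 1\<close>]] by blast
    \<comment> \<open>The factor of an edge is a measurable function of the whole process of that
      edge, so independence of the processes passes to these factors although each involves several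
      times.\<close>
    have mb: "(\<lambda>f. \<Prod>t\<in>etimes x ws e. f t :: complex) \<in> borel_measurable (PiM {1..} (\<lambda>_. borel))" for e
      using tm by (intro borel_measurable_prod measurable_component_singleton) auto
    have "P.indep_vars (\<lambda>_. borel) (\<lambda>e \<omega>. \<Prod>t\<in>etimes x ws e. ?Y e \<omega> t) (edges x ws)"
      by (rule P.indep_vars_compose2[OF iv, where Y = "\<lambda>e f. \<Prod>t\<in>etimes x ws e. f t", OF mb])
    moreover have "(\<Prod>t\<in>etimes x ws e. ?Y e \<omega> t) = (\<Prod>t\<in>etimes x ws e. W N t \<omega> $$ e)" for e \<omega>
      using tm[of _ e] by (intro prod.cong refl) (auto split: prod.split)
    ultimately show "P.indep_vars (\<lambda>_. borel) (\<lambda>e \<omega>. \<Prod>t\<in>etimes x ws e. W N t \<omega> $$ e) (edges x ws)"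
      by simp
  next
    fix e assume "e \<in> edges x ws"
    have "integrable (M N) (\<lambda>\<omega>. \<Prod>(t, f)\<in>(\<lambda>t. (t, e)) ` etimes x ws e. W N t \<omega> $$ f)"
    proof (rule prod_entries_integrable(1)[OF finite_imageI[OF finite_etimes] _ \<open>N \<ge> 1\<close>])
      fix t f assume "(t, f) \<in> (\<lambda>t. (t, e)) ` etimes x ws e"
      then have "(t, f) \<in> tedges x ws" by (auto simp: etimes_def)
      then show "t \<ge> 1 \<and> fst f < N \<and> snd f < N" by (rule idx)
    qed
    then show "integrable (M N) (\<lambda>\<omega>. \<Prod>t\<in>etimes x ws e. W N t \<omega> $$ e)"
      by (simp add: prod.reindex inj_on_def)
  qed
  finally show "(\<integral>\<omega>. walk_weight (\<lambda>k. W N k \<omega>) x ws \<partial>M N)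
      = (\<Prod>e\<in>edges x ws. \<integral>\<omega>. (\<Prod>t\<in>etimes x ws e. W N t \<omega> $$ e) \<partial>M N)" .
qed

lemma expectation_walk_weight_bound:
  assumes c: "\<forall>n N k i j. k \<ge> 1 \<longrightarrow> i < N \<longrightarrow> j < N \<longrightarrow>
      (\<integral>\<omega>. cmod (W N k \<omega> $$ (i, j)) ^ n \<partial>M N) \<le> c n"
    and "distinct (map fst ws)" "\<forall>t\<in>fst ` set ws. t \<ge> 1" "verts x ws \<subseteq> {..<N}" "ws \<noteq> []"
  shows "cmod (\<integral>\<omega>. walk_weight (\<lambda>k. W N k \<omega>) x ws \<partial>M N) \<le> real (length ws) * c (length ws)"
proof -
  have "N \<ge> 1" using assms(4) by (cases N) (auto simp: verts_def)
  have idx: "t \<ge> 1 \<and> fst e < N \<and> snd e < N" if "(t, e) \<in> tedges x ws" for t e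
    using tedges_fst[OF that] assms(3) by (rule_tac tedges_indices[OF that assms(4)]) auto
  have m: "(\<lambda>\<omega>. walk_weight (\<lambda>k. W N k \<omega>) x ws) \<in> borel_measurable (M N)"
    by (rule walk_weight_measurable[OF assms(3,4)])
  have i: "integrable (M N) (\<lambda>\<omega>. \<Prod>(t, e)\<in>tedges x ws. W N t \<omega> $$ e)"
    by (rule prod_entries_integrable) (use idx \<open>N \<ge> 1\<close> in auto)
  have cd: "card (tedges x ws) = length ws" by (rule card_tedges[OF assms(2)])
  have "tedges x ws \<noteq> {}" using cd assms(5) by auto
  have "(\<integral>\<omega>. walk_weight (\<lambda>k. W N k \<omega>) x ws \<partial>M N)
      = (\<integral>\<omega>. (\<Prod>(t, e)\<in>tedges x ws. W N t \<omega> $$ e) \<partial>M N)"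
    by (rule integral_cong_AE[OF m borel_measurable_integrable[OF i] AE_walk_weight[OF assms(2-4)]])
  then have "cmod (\<integral>\<omega>. walk_weight (\<lambda>k. W N k \<omega>) x ws \<partial>M N)
      \<le> (\<Sum>(t, e)\<in>tedges x ws. \<integral>\<omega>. cmod (W N t \<omega> $$ e) ^ card (tedges x ws) \<partial>M N)"
    using prod_entries_integrable(2)[OF finite_tedges idx \<open>tedges x ws \<noteq> {}\<close>] by simp
  also have "\<dots> \<le> (\<Sum>(t, e)\<in>tedges x ws. c (length ws))"
  proof (rule sum_mono)
    fix p assume "p \<in> tedges x ws"
    moreover obtain t i j where "p = (t, i, j)" by (metis surj_pair)
    ultimately show "(case p of (t, e) \<Rightarrow> \<integral>\<omega>. cmod (W N t \<omega> $$ e) ^ card (tedges x ws) \<partial>M N)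
        \<le> (case p of (t, e) \<Rightarrow> c (length ws))"
      using idx[of t "(i, j)"] c unfolding cd by simp
  qed
  finally show ?thesis by (simp add: cd case_prod_unfold)
qed

end

section \<open>Asymptotics of the trace\<close>

lemma tendsto_falling_power:
  "(\<lambda>N. (\<Prod>i<k. real (N - i)) / real N ^ k) \<longlonglongrightarrow> 1"
proof -
  have "(\<lambda>N. real (N - i) / real N) \<longlonglongrightarrow> 1" for i
  proof (rule Lim_transform_eventually)
    have "(\<lambda>N. 1 - real i / real N) \<longlonglongrightarrow> 1 - 0"
      by (intro tendsto_diff tendsto_const lim_const_over_n)
    then show "(\<lambda>N. 1 - real i / real N) \<longlonglongrightarrow> 1" by simp
    show "\<forall>\<^sub>F N in sequentially. 1 - real i / real N = real (N - i) / real N"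
      using eventually_ge_at_top[of "Suc i"]
      by eventually_elim (simp add: of_nat_diff diff_divide_distrib)
  qed
  then have "(\<lambda>N. \<Prod>i<k. real (N - i) / real N) \<longlonglongrightarrow> (\<Prod>i<k. 1)"
    by (intro tendsto_prod)
  then show ?thesis by (simp add: prod_dividef)
qed

context wigner_process
begin

lemma expectation_tree_walk:
  assumes V: "V \<in> NC2 m" and w: "(x, ws) \<in> tree_walks N [1..<Suc m] V"
  shows "(\<integral>\<omega>. walk_weight (\<lambda>k. W N k \<omega>) x ws \<partial>M N) = complex_of_real (arc_weight \<rho> V)"
proof -
  have ts: "map fst ws = [1..<Suc m]" and vN: "verts x ws \<subseteq> {..<N}" and kp: "kernel_partition x ws = V"
    using w by (auto simp: tree_walks_def closed_walks_def)
  have dist: "distinct (map fst ws)" unfolding ts by simp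
  have pos: "\<forall>t\<in>fst ` set ws. t \<ge> 1"
    unfolding list.set_map[symmetric] ts by auto
  have "(\<integral>\<omega>. (\<Prod>t\<in>etimes x ws e. W N t \<omega> $$ e) \<partial>M N)
      = complex_of_real (\<rho> ^ (Max (etimes x ws e) - Min (etimes x ws e)))" if e: "e \<in> edges x ws" for e
  proof -
    have "etimes x ws e \<in> V" using e kp by (auto simp: kernel_partition_def)
    then have "card (etimes x ws e) = 2" using V by (auto simp: NC2_def)
    then obtain s t where st: "etimes x ws e = {s, t}" "s < t"
      "Min (etimes x ws e) = s" "Max (etimes x ws e) = t" by (rule card_2_natE)
    then have se: "(s, e) \<in> tedges x ws" by (auto simp: etimes_def)
    then obtain i j where ij: "e = (i, j)" "i \<le> j" "j < N" using vN by (rule tedges_indices)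
    have "s \<ge> 1" using pos tedges_fst[OF se] by blast
    then show ?thesis using st covariance[of s t i N j] ij by simp
  qed
  then have "(\<integral>\<omega>. walk_weight (\<lambda>k. W N k \<omega>) x ws \<partial>M N)
      = (\<Prod>e\<in>edges x ws. complex_of_real (\<rho> ^ (Max (etimes x ws e) - Min (etimes x ws e))))"
    unfolding expectation_walk_weight(2)[OF dist pos vN] by (intro prod.cong refl)
  also have "\<dots> = complex_of_real (arc_weight \<rho> V)"
    unfolding arc_weight_def kp[symmetric] kernel_partition_def of_real_prod
    using inj_on_etimes[OF dist] by (simp add: prod.reindex)
  finally show ?thesis .
qed

lemma expectation_singleton_edge:
  assumes "distinct (map fst ws)" "\<forall>t\<in>fst ` set ws. t \<ge> 1" "verts x ws \<subseteq> {..<N}"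
    and e: "e \<in> edges x ws" "card (etimes x ws e) = 1"
  shows "(\<integral>\<omega>. walk_weight (\<lambda>k. W N k \<omega>) x ws \<partial>M N) = 0"
proof -
  obtain s where s: "etimes x ws e = {s}" using e(2) card_1_singletonE by blast
  then have se: "(s, e) \<in> tedges x ws" by (auto simp: etimes_def)
  then obtain i j where ij: "e = (i, j)" "i \<le> j" "j < N" using assms(3) by (rule tedges_indices)
  have "s \<ge> 1" using assms(2) tedges_fst[OF se] by blast
  then have "(\<integral>\<omega>. (\<Prod>t\<in>etimes x ws e. W N t \<omega> $$ e) \<partial>M N) = 0"
    using s ij mean_zero[of s i N j] by simp
  then show ?thesis
    unfolding expectation_walk_weight(2)[OF assms(1-3)] using e(1) finite_edges by (intro prod_zero) auto
qed

lemma trace_state_expansion: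
  assumes "N \<ge> 1"
  shows "trace_state (M N) N (scaled_product W N m) =
    (\<Sum>(x, ws)\<in>closed_walks N [1..<Suc m]. \<integral>\<omega>. walk_weight (\<lambda>k. W N k \<omega>) x ws \<partial>M N) /
      complex_of_real (sqrt (real N) ^ m * real N)"
proof -
  let ?c = "complex_of_real (1 / sqrt (real N)) ^ m" and ?C = "closed_walks N [1..<Suc m]"
  have int: "integrable (M N) (\<lambda>\<omega>. walk_weight (\<lambda>k. W N k \<omega>) (fst p) (snd p))" if "p \<in> ?C" for p
  proof -
    have "map fst (snd p) = [1..<Suc m]" "verts (fst p) (snd p) \<subseteq> {..<N}"
      using that by (auto simp: closed_walks_def)
    moreover have "\<forall>t\<in>fst ` set (snd p). t \<ge> 1"
      unfolding list.set_map[symmetric] calculation(1) by auto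
    ultimately show ?thesis by (intro expectation_walk_weight(1)) simp_all
  qed
  have "(\<integral>\<omega>. mat_trace (scaled_product W N m \<omega>) \<partial>M N)
      = (\<integral>\<omega>. ?c * (\<Sum>p\<in>?C. walk_weight (\<lambda>k. W N k \<omega>) (fst p) (snd p)) \<partial>M N)"
  proof (rule Bochner_Integration.integral_cong[OF refl])
    fix \<omega> assume "\<omega> \<in> space (M N)"
    then have "W N k \<omega> \<in> carrier_mat N N" if "k \<ge> 1" for k
      using carrier[OF assms that] by blast
    then show "mat_trace (scaled_product W N m \<omega>)
        = ?c * (\<Sum>p\<in>?C. walk_weight (\<lambda>k. W N k \<omega>) (fst p) (snd p))"
      using mat_trace_scaled_product[of W N \<omega> m] unfolding case_prod_unfold by blast
  qed
  also have "\<dots> = ?c * (\<Sum>p\<in>?C. \<integral>\<omega>. walk_weight (\<lambda>k. W N k \<omega>) (fst p) (snd p) \<partial>M N)"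
    unfolding integral_mult_right_zero by (subst Bochner_Integration.integral_sum[OF int]) simp_all
  finally show ?thesis
    unfolding trace_state_def case_prod_unfold by (simp add: power_divide field_simps)
qed

lemma tree_walks_rest:
  assumes "(x, ws) \<in> closed_walks N [1..<Suc m]"
    and "\<And>V. V \<in> NC2 m \<Longrightarrow> (x, ws) \<notin> tree_walks N [1..<Suc m] V"
    and "(\<integral>\<omega>. walk_weight (\<lambda>k. W N k \<omega>) x ws \<partial>M N) \<noteq> 0"
  shows "card (verts x ws) \<le> Suc m div 2"
proof (rule ccontr)
  assume "\<not> ?thesis"
  moreover have "length [1..<Suc m] = m" by (simp del: upt_Suc)
  \<comment> \<open>\<open>Suc m div 2\<close> is m/2 rounded up, so having more vertices than that
    gives at least m/2 + 1 of them in either parity.\<close>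
  ultimately have many: "length [1..<Suc m] + 2 \<le> 2 * card (verts x ws)" by presburger
  have ts: "map fst ws = [1..<Suc m]" and vN: "verts x ws \<subseteq> {..<N}"
    using assms(1) by (auto simp: closed_walks_def)
  have dist: "distinct (map fst ws)" unfolding ts by simp
  have pos: "\<forall>t\<in>fst ` set ws. t \<ge> 1" unfolding list.set_map[symmetric] ts by auto
  have rep: "card (etimes x ws e) \<noteq> 1" if "e \<in> edges x ws" for e
    using expectation_singleton_edge[OF dist pos vN that] assms(3) by blast
  have srt: "sorted_wrt (<) [1..<Suc m]" by (rule sorted_wrt_upt)
  have "set [1..<Suc m] = {1..m}" by auto
  then have "kernel_partition x ws \<in> NC2 m"
    using closed_walks_tree_walks(1)[OF assms(1) srt many rep] by (simp add: NC2_eq)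
  then show False
    using closed_walks_tree_walks(2)[OF assms(1) srt many rep] assms(2) by blast
qed

text \<open>Both parities are covered at once: for odd \<open>m\<close> there are no pairings and
  only the error, of order 1 / sqrt N, remains. For even \<open>m\<close> each pairing contributes a
  falling product with as many factors as the normalization has powers of \<open>N\<close>.\<close>

lemma trace_state_tendsto:
  assumes "m \<ge> 1"
  shows "(\<lambda>N. trace_state (M N) N (scaled_product W N m))
    \<longlonglongrightarrow> complex_of_real (\<Sum>V\<in>NC2 m. arc_weight \<rho> V)"
proof -
  let ?ts = "[1..<Suc m]" and ?r = "Suc m div 2"
  define E where "E N p = (\<integral>\<omega>. walk_weight (\<lambda>k. W N k \<omega>) (fst p) (snd p) \<partial>M N)" for N p
  \<comment> \<open>A walk in \<open>R N\<close> has expectation zero or at most \<open>?r\<close>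
    vertices: with more vertices it would belong to a tree class or use some edge exactly
    once.\<close>
  define R where "R N = closed_walks N ?ts - (\<Union>V\<in>NC2 m. tree_walks N ?ts V)" for N
  define d where "d N = sqrt (real N) ^ m * real N" for N
  obtain c where c: "\<forall>n N k i j. k \<ge> 1 \<longrightarrow> i < N \<longrightarrow> j < N \<longrightarrow>
      (\<integral>\<omega>. cmod (W N k \<omega> $$ (i, j)) ^ n \<partial>M N) \<le> c n"
    using moments_bounded by blast
  have finNC: "finite (NC2 m)" by (simp add: NC2_eq finite_nc_pairings)
  have setts: "set ?ts = {1..m}" by auto
  have srt: "sorted_wrt (<) ?ts" by (rule sorted_wrt_upt)
  have main: "(\<Sum>p\<in>tree_walks N ?ts V. E N p)
      = complex_of_real ((\<Prod>i<Suc (m div 2). real (N - i)) * arc_weight \<rho> V)"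
    if V: "V \<in> NC2 m" for N V
  proof -
    have V': "V \<in> nc_pairings (set ?ts)" using V by (simp only: setts NC2_eq)
    have "E N p = complex_of_real (arc_weight \<rho> V)" if "p \<in> tree_walks N ?ts V" for p
      using that expectation_tree_walk[OF V, of "fst p" "snd p" N] by (simp add: E_def)
    then have "(\<Sum>p\<in>tree_walks N ?ts V. E N p)
        = of_nat (card (tree_walks N ?ts V)) * complex_of_real (arc_weight \<rho> V)" by simp
    then show ?thesis using card_tree_walks(1)[OF V' srt, of N] by simp
  qed
  have split: "(\<Sum>p\<in>closed_walks N ?ts. E N p)
      = (\<Sum>V\<in>NC2 m. \<Sum>p\<in>tree_walks N ?ts V. E N p) + (\<Sum>p\<in>R N. E N p)" for N
  proof -
    let ?T = "\<Union>V\<in>NC2 m. tree_walks N ?ts V"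
    have sub: "?T \<subseteq> closed_walks N ?ts" by (auto simp: tree_walks_def)
    have "(\<Sum>p\<in>?T. E N p) = (\<Sum>V\<in>NC2 m. \<Sum>p\<in>tree_walks N ?ts V. E N p)"
    proof (rule sum.UNION_disjoint[OF finNC])
      show "\<forall>V\<in>NC2 m. finite (tree_walks N ?ts V)"
        using finite_subset[OF sub card_closed_walks_le(1)] finNC by simp
      show "\<forall>V\<in>NC2 m. \<forall>V'\<in>NC2 m. V \<noteq> V' \<longrightarrow> tree_walks N ?ts V \<inter> tree_walks N ?ts V' = {}"
        by (auto simp: tree_walks_def)
    qed
    then show ?thesis
      unfolding R_def using sum.subset_diff[OF sub card_closed_walks_le(1), of "E N"]
      by (simp only: add.commute)
  qed
  \<comment> \<open>The sign of \<open>c m\<close> is not part of the hypothesis; it is read off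
    from one entry, that of the 1 x 1 matrix at time 1.\<close>
  have cm: "0 \<le> real m * c m"
  proof -
    have "0 \<le> (\<integral>\<omega>. cmod (W 1 1 \<omega> $$ (0, 0)) ^ m \<partial>M 1)" by simp
    also have "\<dots> \<le> c m" using c by simp
    finally show ?thesis by simp
  qed
  define K where "K = real (?r ^ Suc m) * (real m * c m)"
  have err: "cmod (\<Sum>p\<in>R N. E N p) \<le> K * real N ^ ?r" if N: "N \<ge> 1" for N
  proof -
    let ?S = "{(x, ws) \<in> closed_walks N ?ts. card (verts x ws) \<le> ?r}"
    have finS: "finite ?S" by (rule finite_subset[OF _ card_closed_walks_le(1)[of N ?ts]]) auto
    have "(\<Sum>p\<in>R N. E N p) = (\<Sum>p\<in>R N \<inter> ?S. E N p)"
    proof (rule sum.mono_neutral_right)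
      show "finite (R N)" unfolding R_def using card_closed_walks_le(1) by simp
      show "\<forall>p\<in>R N - R N \<inter> ?S. E N p = 0"
        using tree_walks_rest[of _ _ N m] unfolding R_def E_def by fastforce
    qed auto
    also have "cmod \<dots> \<le> (\<Sum>p\<in>R N \<inter> ?S. cmod (E N p))" by (rule norm_sum)
    also have "\<dots> \<le> (\<Sum>p\<in>R N \<inter> ?S. real m * c m)"
    proof (rule sum_mono)
      fix p assume "p \<in> R N \<inter> ?S"
      then have ts: "map fst (snd p) = ?ts" and vN: "verts (fst p) (snd p) \<subseteq> {..<N}"
        by (auto simp: closed_walks_def)
      have len: "length (snd p) = m" using ts by (metis length_map length_upt diff_Suc_1)
      have "\<forall>t\<in>fst ` set (snd p). t \<ge> 1" unfolding list.set_map[symmetric] ts by auto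
      moreover have "distinct (map fst (snd p))" unfolding ts by simp
      moreover have "snd p \<noteq> []" using len assms by auto
      ultimately show "cmod (E N p) \<le> real m * c m"
        unfolding E_def using expectation_walk_weight_bound[OF c _ _ vN] len by metis
    qed
    also have "\<dots> \<le> (\<Sum>p\<in>?S. real m * c m)"
      by (rule sum_mono2[OF finS]) (use cm in auto)
    also have "\<dots> = real (card ?S) * (real m * c m)" by simp
    also have "\<dots> \<le> real (N ^ ?r * ?r ^ Suc (length ?ts)) * (real m * c m)"
      using card_closed_walks_le(2)[OF N, of ?ts ?r] cm
      by (intro mult_right_mono) (simp_all only: of_nat_le_iff)
    finally show ?thesis by (simp add: K_def mult_ac del: upt_Suc)
  qed
  have K0: "0 \<le> K" using cm by (simp add: K_def)
  have lim_main: "(\<lambda>N. complex_of_real ((\<Prod>i<Suc (m div 2). real (N - i)) / d N * arc_weight \<rho> V))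
      \<longlonglongrightarrow> complex_of_real (1 * arc_weight \<rho> V)" if V: "V \<in> NC2 m" for V
  proof -
    \<comment> \<open>A pairing exists only for even \<open>m\<close>; this turns the power of sqrt
      N in \<open>d N\<close> into an integral power of \<open>N\<close>.\<close>
    have "even m" using NC2_odd V by blast
    then obtain n where n: "m = 2 * n" by blast
    have "d N = real N ^ Suc (m div 2)" for N by (simp add: d_def n power_mult)
    then show ?thesis
      using tendsto_falling_power[of "Suc (m div 2)"] by (intro tendsto_of_real tendsto_mult tendsto_const) simp
  qed
  have lim_err: "(\<lambda>N. (\<Sum>p\<in>R N. E N p) / complex_of_real (d N)) \<longlonglongrightarrow> 0"
  proof (rule Lim_null_comparison)
    show "(\<lambda>N. K / sqrt (real N)) \<longlonglongrightarrow> 0"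
      by (intro real_tendsto_divide_at_top[OF tendsto_const]
          filterlim_compose[OF sqrt_at_top filterlim_real_sequentially])
    show "\<forall>\<^sub>F N in sequentially. norm ((\<Sum>p\<in>R N. E N p) / complex_of_real (d N)) \<le> K / sqrt (real N)"
      using eventually_ge_at_top[of 1]
    proof eventually_elim
      case (elim N)
      let ?s = "sqrt (real N)"
      have s: "?s \<ge> 1" "?s ^ 2 = real N" using elim by auto
      have d0: "d N > 0" using elim by (simp add: d_def)
      \<comment> \<open>Here \<open>2 * ?r \<le> m + 1\<close>, whereas \<open>d N\<close> is the
        power \<open>m + 2\<close> of sqrt N: the error loses at least one factor sqrt N.\<close>
      have "real N ^ ?r = ?s ^ (2 * ?r)" unfolding power_mult s(2) ..
      also have "\<dots> \<le> ?s ^ Suc m" using s(1) by (intro power_increasing) auto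
      finally have le: "real N ^ ?r \<le> ?s ^ Suc m" .
      have "norm ((\<Sum>p\<in>R N. E N p) / complex_of_real (d N)) = cmod (\<Sum>p\<in>R N. E N p) / d N"
        using d0 by (simp add: norm_divide)
      also have "\<dots> \<le> K * ?s ^ Suc m / d N"
        using err[OF elim] mult_left_mono[OF le K0] d0 by (intro divide_right_mono) auto
      also have "\<dots> = K / ?s"
        using s elim by (simp add: d_def field_simps power2_eq_square)
      finally show ?case .
    qed
  qed
  have lim: "(\<lambda>N. (\<Sum>V\<in>NC2 m. complex_of_real ((\<Prod>i<Suc (m div 2). real (N - i)) / d N * arc_weight \<rho> V))
      + (\<Sum>p\<in>R N. E N p) / complex_of_real (d N))
      \<longlonglongrightarrow> (\<Sum>V\<in>NC2 m. complex_of_real (1 * arc_weight \<rho> V)) + 0"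
    by (intro tendsto_add tendsto_sum lim_main lim_err)
  have ev: "\<forall>\<^sub>F N in sequentially.
      (\<Sum>V\<in>NC2 m. complex_of_real ((\<Prod>i<Suc (m div 2). real (N - i)) / d N * arc_weight \<rho> V))
      + (\<Sum>p\<in>R N. E N p) / complex_of_real (d N) = trace_state (M N) N (scaled_product W N m)"
    using eventually_ge_at_top[of 1]
  proof eventually_elim
    case (elim N)
    have "trace_state (M N) N (scaled_product W N m)
        = (\<Sum>p\<in>closed_walks N ?ts. E N p) / complex_of_real (d N)"
      unfolding trace_state_expansion[OF elim] E_def d_def case_prod_unfold ..
    also have "\<dots> = (\<Sum>V\<in>NC2 m. complex_of_real ((\<Prod>i<Suc (m div 2). real (N - i)) * arc_weight \<rho> V))
        / complex_of_real (d N) + (\<Sum>p\<in>R N. E N p) / complex_of_real (d N)"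
      unfolding split add_divide_distrib by (simp only: main cong: sum.cong)
    finally show ?case by (simp add: sum_divide_distrib)
  qed
  show ?thesis using Lim_transform_eventually[OF lim ev] by simp
qed

end

theorem proposition2:
  fixes \<rho> :: real
    and M :: "nat \<Rightarrow> 'w measure"
    and W :: "nat \<Rightarrow> nat \<Rightarrow> 'w \<Rightarrow> complex mat"
  assumes "\<bar>\<rho>\<bar> \<le> 1"
    and "wigner_process \<rho> M W"
  shows "(\<forall>n\<ge>1. (\<lambda>N. trace_state (M N) N (scaled_product W N (2 * n - 1))) \<longlonglongrightarrow> 0) \<and>
    (\<forall>n\<ge>1. (\<lambda>N. trace_state (M N) N (scaled_product W N (2 * n)))
      \<longlonglongrightarrow> complex_of_real (\<rho> ^ n * (\<Sum>V\<in>NC2 (2 * n). \<rho> ^ (2 * nest V)))) \<and>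
    (\<forall>h :: 'h :: {real_inner, polish_space}. 0 < \<rho> \<longrightarrow> norm h = sqrt \<rho> \<longrightarrow>
      (\<forall>n\<ge>1. (\<lambda>N. trace_state (M N) N (scaled_product W N n))
        \<longlonglongrightarrow> vacuum_state (\<rho>\<^sup>2) (semicircular (\<rho>\<^sup>2) h ^^ n)))"
proof -
  interpret wigner_process \<rho> M W by fact
  have limit: "(\<lambda>N. trace_state (M N) N (scaled_product W N m))
      \<longlonglongrightarrow> complex_of_real (\<Sum>V\<in>NC2 m. arc_weight \<rho> V)" if "m \<ge> 1" for m
    using trace_state_tendsto[OF that] .
  have "(\<lambda>N. trace_state (M N) N (scaled_product W N (2 * n - 1))) \<longlonglongrightarrow> 0" if "n \<ge> 1" for n
    using limit[of "2 * n - 1"] NC2_odd[of "2 * n - 1"] that by simp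
  moreover have "(\<lambda>N. trace_state (M N) N (scaled_product W N (2 * n)))
      \<longlonglongrightarrow> complex_of_real (\<rho> ^ n * (\<Sum>V\<in>NC2 (2 * n). \<rho> ^ (2 * nest V)))" if "n \<ge> 1" for n
  proof -
    have "(\<Sum>V\<in>NC2 (2 * n). arc_weight \<rho> V) = \<rho> ^ n * (\<Sum>V\<in>NC2 (2 * n). \<rho> ^ (2 * nest V))"
      unfolding sum_distrib_left by (intro sum.cong refl arc_weight_nest)
    then show ?thesis using limit[of "2 * n"] that by simp
  qed
  moreover have "(\<lambda>N. trace_state (M N) N (scaled_product W N n))
      \<longlonglongrightarrow> vacuum_state (\<rho>\<^sup>2) (semicircular (\<rho>\<^sup>2) h ^^ n)"
    if "0 < \<rho>" "norm h = sqrt \<rho>" "n \<ge> 1" for n and h :: 'h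
    using limit[OF that(3)] vacuum_state_eq[of \<rho> h n] that assms(1) by simp
  ultimately show ?thesis by blast
qed


end
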